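(* Let $\alpha\in\mathbb{R}\setminus\mathbb{Q}$, let $\mathfrak{p}:\mathbb{T}\to(0,1)$ be a continuous function and $\mathfrak{q}=1-\mathfrak{p}$. Assume that $\mathfrak{p}$ is symmetric, i.e. $\int_{\mathbb{T}}\log\frac{\mathfrak{p}(x)}{\mathfrak{q}(x)}\,dx=0$, and that the function $x\mapsto\log\frac{\mathfrak{p}(x)}{\mathfrak{q}(x)}$ is continuous and of bounded variation on $\mathbb{T}$. Then the Markov process $(X_n)$ on $\mathbb{T}$ with transition kernel $p(x,\cdot)=\mathfrak{p}(x)\delta_{x+\alpha}+\mathfrak{q}(x)\delta_{x-\alpha}$ is uniquely ergodic, i.e. it has exactly one stationary Borel probability measure.
   Context: $\mathbb{T}=\mathbb{R}/\mathbb{Z}$ is the circle, and $dx$ is Lebesgue measure on it. For a Borel probability measure $\mu$ on $\mathbb{T}$, $\mathbb{E}_\mu$ denotes expectation when $X_0$ has distribution $\mu$. A Borel probability measure $\mu$ on $\mathbb{T}$ is called stationary if $\mathbb{E}_\mu\varphi(X_n)=\mathbb{E}_\mu\varphi(X_0)$ for every continuous $\varphi:\mathbb{T}\to\mathbb{R}$ and every $n\ge 0$. *)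

theory Defs
  imports "HOL-Probability.Probability"
begin

quotient_type circle = real / "\<lambda>x y. x - y \<in> \<int>"
proof (rule equivpI)
  show "reflp (\<lambda>x y :: real. x - y \<in> \<int>)"
    by (simp add: reflp_def)
  show "symp (\<lambda>x y :: real. x - y \<in> \<int>)"
    unfolding symp_def by (metis Ints_minus minus_diff_eq)
  show "transp (\<lambda>x y :: real. x - y \<in> \<int>)"
  proof (rule transpI)
    fix x y z :: real
    assume "x - y \<in> \<int>" "y - z \<in> \<int>"
    then have "(x - y) + (y - z) \<in> \<int>"
      by (rule Ints_add)
    then show "x - z \<in> \<int>"
      by simp
  qed
qed

lift_definition to_circle :: "real \<Rightarrow> circle" is "\<lambda>x. x" .

lemma to_circle_eq_iff: "to_circle x = to_circle y \<longleftrightarrow> x - y \<in> \<int>"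
  by transfer simp

lemma surj_to_circle: "surj to_circle"
proof -
  have "\<exists>t. c = to_circle t" for c
    by transfer (metis Ints_0 diff_self)
  then show ?thesis
    by (auto simp: surj_def)
qed

instantiation circle :: ab_group_add
begin

lift_definition zero_circle :: circle is 0 .

lift_definition plus_circle :: "circle \<Rightarrow> circle \<Rightarrow> circle" is "(+)"
proof -
  fix a b c d :: real
  assume "a - b \<in> \<int>" "c - d \<in> \<int>"
  then have "(a - b) + (c - d) \<in> \<int>"
    by (rule Ints_add)
  then show "a + c - (b + d) \<in> \<int>"
    by (simp add: algebra_simps)
qed

lift_definition uminus_circle :: "circle \<Rightarrow> circle" is uminus
proof -
  fix a b :: real
  assume "a - b \<in> \<int>"
  then have "- (a - b) \<in> \<int>"
    by (rule Ints_minus)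
  then show "- a - - b \<in> \<int>"
    by simp
qed

lift_definition minus_circle :: "circle \<Rightarrow> circle \<Rightarrow> circle" is "(-)"
proof -
  fix a b c d :: real
  assume "a - b \<in> \<int>" "c - d \<in> \<int>"
  then have "(a - b) - (c - d) \<in> \<int>"
    by (rule Ints_diff)
  then show "a - c - (b - d) \<in> \<int>"
    by (simp add: algebra_simps)
qed

instance
  by (intro_classes; transfer) (simp_all add: algebra_simps)

end

lemma to_circle_add: "to_circle (x + y) = to_circle x + to_circle y"
  by transfer simp

lemma to_circle_diff: "to_circle (x - y) = to_circle x - to_circle y"
  by transfer simp

instantiation circle :: topological_space
begin

definition open_circle :: "circle set \<Rightarrow> bool"
  where "open_circle U \<longleftrightarrow> open (to_circle -` U)"

instance
  by intro_classes (auto simp: open_circle_def vimage_Union)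

end

lemma continuous_on_to_circle: "continuous_on S to_circle"
  by (rule continuous_on_subset[of UNIV])
    (auto simp: continuous_on_open_vimage open_circle_def)

lemma continuous_on_add_circle: "continuous_on UNIV (\<lambda>x. x + c :: circle)"
proof -
  obtain s where s: "c = to_circle s"
    using surj_to_circle by (auto simp: surj_def)
  have "open ((\<lambda>x. x + c) -` U)" if "open U" for U :: "circle set"
  proof -
    have "to_circle -` ((\<lambda>x. x + c) -` U) = (\<lambda>t. t + s) -` (to_circle -` U)"
      by (auto simp: s to_circle_add)
    also have "open \<dots>"
      by (rule open_vimage[OF that[unfolded open_circle_def]]) (intro continuous_intros)
    finally show ?thesis
      by (simp add: open_circle_def)
  qed
  then show ?thesis
    by (simp add: continuous_on_open_vimage)
qed

lemma measurable_add_circle [measurable]: "(\<lambda>x. x + c :: circle) \<in> borel_measurable borel"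
  by (rule borel_measurable_continuous_onI[OF continuous_on_add_circle])

lemma measurable_diff_circle [measurable]: "(\<lambda>x. x - c :: circle) \<in> borel_measurable borel"
  using measurable_add_circle[of "- c"] by simp

definition circle_lebesgue :: "circle measure" where
  "circle_lebesgue = distr (restrict_space lborel {0..<1}) borel to_circle"

text \<open>
  Finite variation on the circle is expressed by the 1-periodic lift, over the closed interval
  \<open>{0..1}\<close>, so that the jump across the base point is counted.
\<close>

definition bounded_variation_circle :: "(circle \<Rightarrow> real) \<Rightarrow> bool" where
  "bounded_variation_circle f \<longleftrightarrow>
     (\<exists>C. \<forall>n (t :: nat \<Rightarrow> real). mono_on {..n} t \<and> t ` {..n} \<subseteq> {0..1} \<longrightarrow>
        (\<Sum>i<n. \<bar>f (to_circle (t (Suc i))) - f (to_circle (t i))\<bar>) \<le> C)"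

text \<open>
  The law, on the space of trajectories, of the Markov process with initial distribution \<open>\<mu>\<close>
  and transition kernel \<open>K\<close>, given by the Ionescu-Tulcea theorem; the process itself is the
  coordinate process.
\<close>

definition step_kernel ::
    "('a \<Rightarrow> 'a measure) \<Rightarrow> 'a measure \<Rightarrow> nat \<Rightarrow> (nat \<Rightarrow> 'a) \<Rightarrow> 'a measure" where
  "step_kernel K \<mu> n \<omega> = (case n of 0 \<Rightarrow> \<mu> | Suc m \<Rightarrow> K (\<omega> m))"

definition markov_law ::
    "('a :: topological_space \<Rightarrow> 'a measure) \<Rightarrow> 'a measure \<Rightarrow> (nat \<Rightarrow> 'a) measure" where
  "markov_law K \<mu> =
     projective_family.lim UNIV (Ionescu_Tulcea.CI (step_kernel K \<mu>) (\<lambda>_. borel)) (\<lambda>_. borel)"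

definition stationary :: "('a :: topological_space \<Rightarrow> 'a measure) \<Rightarrow> 'a measure \<Rightarrow> bool" where
  "stationary K \<mu> \<longleftrightarrow>
     prob_space \<mu> \<and> sets \<mu> = sets borel \<and>
     (\<forall>\<phi> :: 'a \<Rightarrow> real. continuous_on UNIV \<phi> \<longrightarrow>
        (\<forall>n. (\<integral>\<omega>. \<phi> (\<omega> n) \<partial>markov_law K \<mu>) = (\<integral>\<omega>. \<phi> (\<omega> 0) \<partial>markov_law K \<mu>)))"

definition uniquely_ergodic :: "('a :: topological_space \<Rightarrow> 'a measure) \<Rightarrow> bool" where
  "uniquely_ergodic K \<longleftrightarrow> (\<exists>!\<mu>. stationary K \<mu>)"

context
  fixes K :: "'a :: topological_space \<Rightarrow> 'a measure" and \<mu> :: "'a measure"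
  assumes K: "K \<in> measurable borel (prob_algebra borel)"
    and \<mu>: "prob_space \<mu>" "sets \<mu> = sets borel"
begin

lemma Ionescu_Tulcea_step_kernel: "Ionescu_Tulcea (step_kernel K \<mu>) (\<lambda>_. borel)"
proof (rule Ionescu_Tulcea.intro)
  note [measurable] = measurable_prob_algebraD[OF K]
  fix i
  show "step_kernel K \<mu> i \<in> measurable (PiM {0..<i} (\<lambda>_. borel)) (subprob_algebra borel)"
  proof (cases i)
    case 0
    have "\<mu> \<in> space (subprob_algebra borel)"
      using \<mu> by (simp add: space_subprob_algebra prob_space_imp_subprob_space)
    then show ?thesis
      by (simp add: 0 step_kernel_def[abs_def])
  next
    case (Suc m)
    show ?thesis
      unfolding Suc step_kernel_def[abs_def] by simp
  qed
next
  fix i and x :: "nat \<Rightarrow> 'a"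
  show "prob_space (step_kernel K \<mu> i x)"
    using \<mu>(1) measurable_space[OF K]
    by (auto simp: step_kernel_def space_prob_algebra split: nat.split)
qed

interpretation IT: Ionescu_Tulcea "step_kernel K \<mu>" "\<lambda>_. borel"
  by (rule Ionescu_Tulcea_step_kernel)

lemma sets_markov_law: "sets (markov_law K \<mu>) = sets (PiM UNIV (\<lambda>_. borel))"
  unfolding markov_law_def by (rule IT.PF.sets_lim)

lemma prob_space_markov_law: "prob_space (markov_law K \<mu>)"
proof -
  have "distr IT.PF.lim (PiM {} (\<lambda>_. borel)) (\<lambda>\<omega>. restrict \<omega> {}) = IT.CI {}"
    by (rule IT.distr_lim) simp
  then have "prob_space (distr IT.PF.lim (PiM {} (\<lambda>_. borel)) (\<lambda>\<omega>. restrict \<omega> {}))"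
    using IT.PF.prob_space_P[of "{}"] by simp
  then show ?thesis
    unfolding markov_law_def
    by (rule prob_space_distrD[rotated])
      (intro measurable_restrict, simp)
qed

lemma distr_markov_law:
  "distr (markov_law K \<mu>) (PiM {0..<n} (\<lambda>_. borel)) (\<lambda>\<omega>. restrict \<omega> {0..<n}) =
     IT.C 0 n (\<lambda>_. undefined)"
proof -
  have "distr (markov_law K \<mu>) (PiM {0..<n} (\<lambda>_. borel)) (\<lambda>\<omega>. restrict \<omega> {0..<n}) =
      IT.CI {0..<n}"
    unfolding markov_law_def by (rule IT.distr_lim) simp
  also have "\<dots> = IT.C 0 n (\<lambda>_. undefined)"
  proof (rule measure_eqI)
    show "sets (IT.CI {0..<n}) = sets (IT.C 0 n (\<lambda>_. undefined))"
      by (simp add: IT.PF.sets_P IT.sets_C)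
    fix A assume "A \<in> sets (IT.CI {0..<n})"
    then have A: "A \<in> sets (PiM {0..<n} (\<lambda>_. borel))"
      by (simp add: IT.PF.sets_P)
    show "emeasure (IT.CI {0..<n}) A = emeasure (IT.C 0 n (\<lambda>_. undefined)) A"
    proof -
      have "prod_emb {0..<n} (\<lambda>_. borel) {0..<n} A = A"
        by (rule prod_emb_id) (use sets.sets_into_space[OF A] in \<open>simp add: space_PiM\<close>)
      then show ?thesis
        using IT.emeasure_CI[OF subset_refl A] by (simp only:)
    qed
  qed
  finally show ?thesis .
qed

lemma nn_integral_markov_law_restrict:
  assumes "f \<in> borel_measurable (PiM {0..<n} (\<lambda>_. borel))"
  shows "(\<integral>\<^sup>+\<omega>. f (restrict \<omega> {0..<n}) \<partial>markov_law K \<mu>) =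
    (\<integral>\<^sup>+\<omega>. f \<omega> \<partial>IT.C 0 n (\<lambda>_. undefined))"
  unfolding distr_markov_law[symmetric] using assms
  by (subst nn_integral_distr)
    (auto intro!: measurable_restrict simp: measurable_cong_sets[OF sets_markov_law refl])

lemma markov_law_initial:
  assumes [measurable]: "f \<in> borel_measurable borel"
  shows "(\<integral>\<^sup>+\<omega>. f (\<omega> 0) \<partial>markov_law K \<mu>) = (\<integral>\<^sup>+x. f x \<partial>\<mu>)"
proof -
  have [simp]: "(\<lambda>_. undefined) \<in> space (PiM {0..<0::nat} (\<lambda>_. borel :: 'a measure))"
    by (simp add: space_PiM)
  have "(\<integral>\<^sup>+\<omega>. f (\<omega> 0) \<partial>markov_law K \<mu>) =
      (\<integral>\<^sup>+\<omega>. f (restrict \<omega> {0..<Suc 0} 0) \<partial>markov_law K \<mu>)"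
    by simp
  also have "\<dots> = (\<integral>\<^sup>+\<omega>. f (\<omega> 0) \<partial>IT.C 0 (Suc 0) (\<lambda>_. undefined))"
    by (rule nn_integral_markov_law_restrict) measurable
  also have "\<dots> = (\<integral>\<^sup>+\<omega>. f (\<omega> 0) \<partial>IT.eP 0 (\<lambda>_. undefined))"
    using bind_return[OF IT.measurable_eP[of 0], of "\<lambda>_. undefined"] by simp
  also have "\<dots> = (\<integral>\<^sup>+x. f x \<partial>step_kernel K \<mu> 0 (\<lambda>_. undefined))"
    by (subst IT.nn_integral_eP) auto
  finally show ?thesis
    by (simp add: step_kernel_def)
qed

lemma markov_law_step:
  assumes g[measurable]: "g \<in> borel_measurable (PiM {0..<Suc n} (\<lambda>_. borel))"
    and f[measurable]: "f \<in> borel_measurable borel"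
  shows "(\<integral>\<^sup>+\<omega>. g (restrict \<omega> {0..<Suc n}) * f (\<omega> (Suc n)) \<partial>markov_law K \<mu>) =
    (\<integral>\<^sup>+\<omega>. g (restrict \<omega> {0..<Suc n}) * (\<integral>\<^sup>+y. f y \<partial>K (\<omega> n)) \<partial>markov_law K \<mu>)"
proof -
  note [measurable] = measurable_prob_algebraD[OF K]
  let ?u = "\<lambda>_::nat. undefined :: 'a"
  have u: "?u \<in> space (PiM {0..<0} (\<lambda>_. borel))"
    by (simp add: space_PiM)
  define h where "h \<omega> = g (restrict \<omega> {0..<Suc n}) * f (\<omega> (Suc n))" for \<omega>
  have [measurable]:
    "(\<lambda>\<omega>. restrict \<omega> {0..<Suc n}) \<in>
       measurable (PiM {0..<Suc (Suc n)} (\<lambda>_. borel :: 'a measure)) (PiM {0..<Suc n} (\<lambda>_. borel))"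
    by (rule measurable_restrict_subset) auto
  have h[measurable]: "h \<in> borel_measurable (PiM {0..<Suc (Suc n)} (\<lambda>_. borel))"
    unfolding h_def[abs_def] by measurable
  have "(\<integral>\<^sup>+\<omega>. g (restrict \<omega> {0..<Suc n}) * f (\<omega> (Suc n)) \<partial>markov_law K \<mu>) =
      (\<integral>\<^sup>+\<omega>. h (restrict \<omega> {0..<Suc (Suc n)}) \<partial>markov_law K \<mu>)"
  proof -
    have "{0..<Suc (Suc n)} \<inter> {0..<Suc n} = {0..<Suc n}"
      by auto
    then show ?thesis
      unfolding h_def restrict_restrict by simp
  qed
  also have "\<dots> = (\<integral>\<^sup>+\<omega>. h \<omega> \<partial>IT.C 0 (Suc (Suc n)) ?u)"
    by (rule nn_integral_markov_law_restrict[OF h])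
  also have "\<dots> = (\<integral>\<^sup>+\<omega>. (\<integral>\<^sup>+\<omega>'. h \<omega>' \<partial>IT.eP (Suc n) \<omega>) \<partial>IT.C 0 (Suc n) ?u)"
    using IT.measurable_eP[of "Suc n"]
    by (subst IT.C.simps(2), subst nn_integral_bind[OF h])
      (simp_all add: measurable_cong_sets[OF IT.sets_C[OF u] refl] del: IT.C.simps)
  also have "\<dots> = (\<integral>\<^sup>+\<omega>. g \<omega> * (\<integral>\<^sup>+y. f y \<partial>K (\<omega> n)) \<partial>IT.C 0 (Suc n) ?u)"
  proof (rule nn_integral_cong)
    fix \<omega> assume "\<omega> \<in> space (IT.C 0 (Suc n) ?u)"
    then have \<omega>: "\<omega> \<in> space (PiM {0..<Suc n} (\<lambda>_. borel))"
      by (subst (asm) IT.space_C[OF u]) simp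
    have [simp]: "restrict (fun_upd \<omega> (Suc n) y) {0..<Suc n} = \<omega>" for y
      using \<omega> by (auto simp: fun_eq_iff space_PiM PiE_def extensional_def restrict_def)
    have sets_K: "sets (K (\<omega> n)) = sets borel"
      using measurable_space[OF K] by (simp add: space_prob_algebra)
    have [measurable]: "f \<in> borel_measurable (K (\<omega> n))"
      using f by (subst measurable_cong_sets[OF sets_K refl])
    show "(\<integral>\<^sup>+\<omega>'. h \<omega>' \<partial>IT.eP (Suc n) \<omega>) = g \<omega> * (\<integral>\<^sup>+y. f y \<partial>K (\<omega> n))"
      by (subst IT.nn_integral_eP[OF \<omega> h]) (simp add: h_def step_kernel_def nn_integral_cmult)
  qed
  also have "\<dots> = (\<integral>\<^sup>+\<omega>. g (restrict \<omega> {0..<Suc n}) *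
      (\<integral>\<^sup>+y. f y \<partial>K (restrict \<omega> {0..<Suc n} n)) \<partial>markov_law K \<mu>)"
    by (rule nn_integral_markov_law_restrict[symmetric]) measurable
  finally show ?thesis
    by simp
qed

end

definition walk_kernel ::
    "real \<Rightarrow> (circle \<Rightarrow> real) \<Rightarrow> (circle \<Rightarrow> real) \<Rightarrow> circle \<Rightarrow> circle measure" where
  "walk_kernel \<alpha> p q x = measure_of UNIV (sets borel)
     (\<lambda>A. ennreal (p x) * emeasure (return borel (x + to_circle \<alpha>)) A +
          ennreal (q x) * emeasure (return borel (x - to_circle \<alpha>)) A)"

lemma sets_walk_kernel [measurable_cong, simp]: "sets (walk_kernel \<alpha> p q x) = sets borel"
  unfolding walk_kernel_def using sets.sigma_sets_eq[of "borel :: circle measure"] by simp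

lemma space_walk_kernel [simp]: "space (walk_kernel \<alpha> p q x) = UNIV"
  by (simp add: walk_kernel_def)

lemma emeasure_walk_kernel:
  assumes "A \<in> sets borel"
  shows "emeasure (walk_kernel \<alpha> p q x) A =
    ennreal (p x) * indicator A (x + to_circle \<alpha>) + ennreal (q x) * indicator A (x - to_circle \<alpha>)"
proof -
  have "emeasure (walk_kernel \<alpha> p q x) A =
      ennreal (p x) * emeasure (return borel (x + to_circle \<alpha>)) A +
      ennreal (q x) * emeasure (return borel (x - to_circle \<alpha>)) A"
    unfolding walk_kernel_def
  proof (rule emeasure_measure_of_sigma)
    show "sigma_algebra UNIV (sets (borel :: circle measure))"
      using sets.sigma_algebra_axioms[of "borel :: circle measure"] by simp
    show "countably_additive (sets borel)
       (\<lambda>A. ennreal (p x) * emeasure (return borel (x + to_circle \<alpha>)) A +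
          ennreal (q x) * emeasure (return borel (x - to_circle \<alpha>)) A)"
    proof (rule countably_additiveI)
      fix B :: "nat \<Rightarrow> circle set"
      assume B: "range B \<subseteq> sets borel" "disjoint_family B"
      show "(\<Sum>i. ennreal (p x) * emeasure (return borel (x + to_circle \<alpha>)) (B i) +
            ennreal (q x) * emeasure (return borel (x - to_circle \<alpha>)) (B i)) =
          ennreal (p x) * emeasure (return borel (x + to_circle \<alpha>)) (\<Union>(range B)) +
          ennreal (q x) * emeasure (return borel (x - to_circle \<alpha>)) (\<Union>(range B))"
        using B suminf_emeasure[of B "return borel (x + to_circle \<alpha>)"]
          suminf_emeasure[of B "return borel (x - to_circle \<alpha>)"]
        by (subst suminf_add[symmetric]) (simp_all del: emeasure_return)
    qed
  qed (use assms in \<open>auto simp: positive_def\<close>)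
  then show ?thesis
    using assms by simp
qed

lemma walk_kernel_measurable:
  assumes [measurable]: "p \<in> borel_measurable borel" "q \<in> borel_measurable borel"
    and "\<And>x. 0 \<le> p x" "\<And>x. 0 \<le> q x" "\<And>x. p x + q x = 1"
  shows "walk_kernel \<alpha> p q \<in> measurable borel (prob_algebra borel)"
proof -
  have prob: "prob_space (walk_kernel \<alpha> p q x)" for x
    by (rule prob_spaceI)
      (use assms in \<open>simp add: emeasure_walk_kernel ennreal_plus[symmetric] del: ennreal_plus\<close>)
  show ?thesis
  proof (rule measurable_prob_algebraI[OF prob], rule measurable_subprob_algebra)
    fix A :: "circle set" assume [measurable]: "A \<in> sets borel"
    show "(\<lambda>x. emeasure (walk_kernel \<alpha> p q x) A) \<in> borel_measurable borel"
      by (simp add: emeasure_walk_kernel)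
  qed (use prob prob_space_imp_subprob_space in auto)
qed

end

theory Submission
  imports Defs
begin

text \<open>
  Write \<open>T x = x + \<alpha>\<close> and \<open>f = ln (p / q)\<close>, so that \<open>exp f = p / q\<close>, and let \<open>S\<^sub>n\<close> be the Birkhoff
  sums of \<open>f\<close> along \<open>T\<close>.

  \<^bold>\<open>Reduction to conformal measures.\<close> For a stationary \<open>\<mu>\<close> consider the current
  \<open>J = T\<^sub>*(p \<mu>) - q \<mu>\<close>, the net flow of mass from \<open>x - \<alpha>\<close> to \<open>x\<close>. Stationarity says that what flows into
  a site flows out of it, i.e. that \<open>J\<close> is \<open>T\<close>-invariant; as \<open>\<alpha>\<close> is irrational, \<open>J\<close> is \<open>c\<close> times
  Lebesgue measure (\<open>rotation_invariant_functional\<close>). If \<open>c = 0\<close>, then \<open>q \<mu>\<close> satisfies detailed balance,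
  \<open>T\<^sub>*(exp f q \<mu>) = q \<mu>\<close>; measures with this property are called conformal here. Conversely a conformal
  probability \<open>\<nu>\<close> yields the stationary measure \<open>\<nu> / q\<close>, up to normalisation. It remains to prove that
  \<open>c = 0\<close> and that there is exactly one conformal probability.

  \<^bold>\<open>Bounded distortion.\<close> All three facts rest on one estimate. Let \<open>m\<close> be the denominator of a
  reduced fraction \<open>h / m\<close> with \<open>\<bar>\<alpha> - h / m\<bar> < 1 / m\<^sup>2\<close>; by Dirichlet there are arbitrarily large such
  \<open>m\<close>. Up to an error of order \<open>1 / m\<close> the first \<open>m\<close> points of an orbit run once through all multiples
  of \<open>1 / m\<close>, so for two starting points at distance at most \<open>2 / m\<close> the sums \<open>S\<^sub>n\<close>, \<open>n \<le> m\<close>, differ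
  by at most a fixed multiple \<open>D\<close> of the variation of \<open>f\<close> (\<open>birkhoff_distortion\<close>). The orbit also returns
  to within \<open>1 / m\<close> at time \<open>m\<close>, which turns this local estimate into a bound on the oscillation of
  \<open>S\<^sub>m\<close> over the whole circle; since \<open>f\<close> has mean zero, \<open>\<bar>S\<^sub>m\<bar> \<le> 2 D\<close> everywhere, the
  Denjoy--Koksma inequality (\<open>birkhoff_good_denominator\<close>).

  \<^bold>\<open>No current.\<close> Iterating \<open>T\<^sub>*(exp f q \<mu>) = q \<mu> + c dx\<close> and taking total masses gives
  \<open>\<integral> exp S\<^sub>m q d\<mu> = \<integral> q d\<mu> + c (\<Sum>k<m. \<integral> exp S\<^sub>k dx)\<close>. Each summand is at least \<open>1\<close> by Jensen's inequality,
  while for good \<open>m\<close> the left side lies between \<open>0\<close> and \<open>exp (2 D)\<close>. Hence \<open>\<bar>c\<bar> m \<le> exp (2 D)\<close> for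
  arbitrarily large \<open>m\<close>, and \<open>c = 0\<close> (\<open>current_vanishes\<close>).

  \<^bold>\<open>Uniqueness of the conformal probability.\<close> Weigh the point \<open>x + i \<alpha>\<close> by \<open>exp (S\<^sub>i x)\<close>. By
  conformality the integral of a test function is an average, over starting points \<open>x\<close>, of its
  weighted means along the first \<open>m\<close> orbit points. By bounded distortion these weighted means are
  comparable for any two starting points, with a constant that depends on \<open>D\<close> only
  (\<open>orbit_sum_comparison\<close>). So any two conformal probabilities are within the factor \<open>exp (8 D)\<close> of
  each other. After subtraction of a multiple of one from the other, the normalised remainder is
  again conformal and the same comparison applies to it; repeating this forces equality
  (\<open>conformal_unique\<close>).

  \<^bold>\<open>Existence.\<close> The weighted orbit segments, normalised, are discrete probabilities that are
  conformal up to an error of order one over their unnormalised mass. That mass tends to infinity,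
  because \<open>exp S\<^sub>m \<ge> exp (- 2 D)\<close> at infinitely many times \<open>m\<close>. Any weak limit is conformal
  (\<open>conformal_measure_exists\<close>).

  Integrals are treated as positive linear functionals on the continuous functions wherever
  possible: differences such as \<open>\<Lambda> - c \<Lambda>'\<close> are then available without signed measures.
\<close>

section \<open>Continuous functions on the circle\<close>

lemma to_circle_of_int [simp]: "to_circle (of_int k) = 0"
  by transfer simp

lemma to_circle_0 [simp]: "to_circle 0 = 0"
  by transfer simp

lemma circle_exhaust: obtains t where "x = to_circle t"
  using surj_to_circle by (auto simp: surj_def)

lemma continuous_on_lift:
  assumes "continuous_on UNIV \<phi>"
  shows "continuous_on S (\<lambda>t. \<phi> (to_circle t))"
  by (rule continuous_on_compose2[OF assms continuous_on_to_circle]) auto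

lemma continuous_on_shift [continuous_intros]:
  fixes \<phi> :: "circle \<Rightarrow> 'a::topological_space"
  assumes "continuous_on UNIV \<phi>"
  shows "continuous_on UNIV (\<lambda>x. \<phi> (x + c))"
  by (rule continuous_on_compose2[OF assms continuous_on_add_circle]) auto

lemma continuous_circle_bounded:
  fixes \<phi> :: "circle \<Rightarrow> real"
  assumes "continuous_on UNIV \<phi>"
  obtains M where "0 < M" "\<And>x. \<bar>\<phi> x\<bar> \<le> M"
proof -
  have "bounded ((\<lambda>t. \<phi> (to_circle t)) ` {0..1})"
    by (intro compact_imp_bounded compact_continuous_image continuous_on_lift assms) simp
  then obtain M where M: "0 < M" "\<And>t. t \<in> {0..1} \<Longrightarrow> \<bar>\<phi> (to_circle t)\<bar> \<le> M"
    by (auto simp: bounded_pos)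
  have "\<bar>\<phi> x\<bar> \<le> M" for x
  proof -
    obtain t where t: "x = to_circle t" by (rule circle_exhaust)
    have "to_circle t = to_circle (frac t)"
      by (simp add: to_circle_eq_iff frac_def)
    with M(2)[of "frac t"] t show ?thesis
      by (simp add: frac_lt_1 less_imp_le)
  qed
  with M(1) that show thesis by blast
qed

lemma continuous_circle_uniform:
  fixes \<phi> :: "circle \<Rightarrow> real"
  assumes "continuous_on UNIV \<phi>" and "0 < \<epsilon>"
  obtains \<delta> where "0 < \<delta>" "\<And>x r. \<bar>r\<bar> \<le> \<delta> \<Longrightarrow> \<bar>\<phi> (x + to_circle r) - \<phi> x\<bar> \<le> \<epsilon>"
proof -
  have "uniformly_continuous_on {-1..2} (\<lambda>t. \<phi> (to_circle t))"
    by (intro compact_uniformly_continuous continuous_on_lift assms) simp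
  then obtain d where d: "0 < d"
    "\<And>s t. s \<in> {-1..2} \<Longrightarrow> t \<in> {-1..2} \<Longrightarrow> \<bar>t - s\<bar> < d \<Longrightarrow>
       \<bar>\<phi> (to_circle t) - \<phi> (to_circle s)\<bar> < \<epsilon>"
    using \<open>0 < \<epsilon>\<close> unfolding uniformly_continuous_on_def dist_real_def by meson
  show thesis
  proof
    show "0 < min 1 (d / 2)" using d by simp
    fix x r assume r: "\<bar>r\<bar> \<le> min 1 (d / 2)"
    obtain t where t: "x = to_circle t" by (rule circle_exhaust)
    have t': "x = to_circle (frac t)"
      by (simp add: t to_circle_eq_iff frac_def)
    have "\<bar>\<phi> (to_circle (frac t + r)) - \<phi> (to_circle (frac t))\<bar> < \<epsilon>"
    proof (rule d(2))
      have "0 \<le> frac t" "frac t < 1" by (simp_all add: frac_lt_1)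
      then show "frac t \<in> {-1..2}" "frac t + r \<in> {-1..2}"
        using r by (simp_all only: atLeastAtMost_iff min_le_iff_disj) linarith+
      show "\<bar>frac t + r - frac t\<bar> < d" using r d(1) by simp
    qed
    then show "\<bar>\<phi> (x + to_circle r) - \<phi> x\<bar> \<le> \<epsilon>"
      unfolding t' to_circle_add by simp
  qed
qed

section \<open>Birkhoff sums and good denominators\<close>

definition birkhoff :: "real \<Rightarrow> (circle \<Rightarrow> real) \<Rightarrow> nat \<Rightarrow> circle \<Rightarrow> real" where
  "birkhoff \<alpha> f n x = (\<Sum>i<n. f (x + to_circle (real i * \<alpha>)))"

lemma birkhoff_0 [simp]: "birkhoff \<alpha> f 0 x = 0"
  by (simp add: birkhoff_def)

lemma birkhoff_add:
  "birkhoff \<alpha> f (m + n) x = birkhoff \<alpha> f m x + birkhoff \<alpha> f n (x + to_circle (real m * \<alpha>))"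
  by (induction n) (simp_all add: birkhoff_def algebra_simps flip: to_circle_add)

lemma birkhoff_Suc: "birkhoff \<alpha> f (Suc n) x = f x + birkhoff \<alpha> f n (x + to_circle \<alpha>)"
  using birkhoff_add[of \<alpha> f 1 n x] by (simp add: birkhoff_def)

lemma continuous_on_birkhoff [continuous_intros]:
  "continuous_on UNIV f \<Longrightarrow> continuous_on UNIV (birkhoff \<alpha> f n)"
  unfolding birkhoff_def[abs_def] by (intro continuous_intros)

text \<open>
  Denominators of the rational approximations given by Dirichlet's theorem. They take the place of
  the denominators of the continued fraction of \<open>\<alpha>\<close>.
\<close>

definition good_denominator :: "real \<Rightarrow> nat \<Rightarrow> bool" where
  "good_denominator \<alpha> q \<longleftrightarrow>
     0 < q \<and> (\<exists>h. coprime h (int q) \<and> \<bar>\<alpha> - of_int h / real q\<bar> < 1 / (real q)\<^sup>2)"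

lemma unbounded_good_denominators:
  assumes "\<alpha> \<notin> \<rat>"
  obtains q where "N < q" "good_denominator \<alpha> q"
proof -
  have "infinite (approx_set \<alpha>)"
    using assms rational_iff_finite_approx_set by blast
  then obtain h k where k: "(h, k) \<in> approx_set \<alpha>" "int N < k"
    using infinite_approx_set by blast
  then have "good_denominator \<alpha> (nat k)"
    by (auto simp: approx_set_def good_denominator_def intro!: exI[of _ h])
  moreover have "N < nat k" using k(2) by simp
  ultimately show thesis using that by blast
qed

text \<open>
  The points \<open>j h / q\<close>, \<open>j < q\<close>, are all the multiples of \<open>1 / q\<close> modulo 1, each hit exactly once.
  This is also used with \<open>h = 1\<close>, where the map is a cyclic shift.
\<close>

lemma bij_affine_mod:
  assumes "coprime h (int q)" "0 < q"
  shows "bij_betw (\<lambda>j. nat ((int j * h + c) mod int q)) {..<q} {..<q}"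
proof -
  let ?g = "\<lambda>j. nat ((int j * h + c) mod int q)"
  have "inj_on ?g {..<q}"
  proof (rule inj_onI)
    fix i j assume ij: "i \<in> {..<q}" "j \<in> {..<q}" "?g i = ?g j"
    then have "(int i * h + c) mod int q = (int j * h + c) mod int q"
      using \<open>0 < q\<close> by (simp add: eq_nat_nat_iff)
    then have "int q dvd (int i - int j) * h"
      by (simp add: mod_eq_dvd_iff algebra_simps)
    then have "int q dvd int i - int j"
      using assms(1) by (simp add: coprime_dvd_mult_left_iff coprime_commute)
    then have "int i mod int q = int j mod int q"
      by (simp add: mod_eq_dvd_iff)
    then show "i = j"
      using ij by simp
  qed
  moreover have "?g ` {..<q} \<subseteq> {..<q}"
    using \<open>0 < q\<close> by (auto simp: nat_less_iff)
  ultimately show ?thesis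
    by (simp add: bij_betw_def endo_inj_surj)
qed

text \<open>
  During \<open>q\<close> steps, rotating by \<open>\<alpha>\<close> instead of \<open>h / q\<close> accumulates an error of at most \<open>1 / q\<close>.
  Distances are measured in units of \<open>1 / q\<close> so that the cells below have integer endpoints.
\<close>

lemma orbit_drift:
  fixes \<alpha> :: real
  assumes "\<bar>\<alpha> - of_int h / real q\<bar> < 1 / (real q)\<^sup>2" "0 < q" "j \<le> q"
  shows "\<bar>real q * (real j * \<alpha>) - of_int (int j * h)\<bar> \<le> 1"
    and "j < q \<Longrightarrow> \<bar>real q * (real j * \<alpha>) - of_int (int j * h)\<bar> < 1"
proof -
  have eq: "real q * (real j * \<alpha>) - of_int (int j * h) = real q * (real j * (\<alpha> - of_int h / real q))"
    using \<open>0 < q\<close> by (simp add: field_simps)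
  have "\<bar>real q * (real j * (\<alpha> - of_int h / real q))\<bar> \<le> real q * (real j * (1 / (real q)\<^sup>2))"
    unfolding abs_mult using assms by (intro mult_mono) auto
  also have "\<dots> = real j / real q"
    using \<open>0 < q\<close> by (simp add: power2_eq_square)
  finally have *: "\<bar>real q * (real j * \<alpha>) - of_int (int j * h)\<bar> \<le> real j / real q"
    unfolding eq .
  show "\<bar>real q * (real j * \<alpha>) - of_int (int j * h)\<bar> \<le> 1"
    using * \<open>j \<le> q\<close> \<open>0 < q\<close> by (elim order_trans) simp
  show "\<bar>real q * (real j * \<alpha>) - of_int (int j * h)\<bar> < 1" if "j < q"
    using * that by (elim order.strict_trans1) simp
qed

lemma good_denominator_return:
  assumes "good_denominator \<alpha> q"
  obtains r where "\<bar>r\<bar> \<le> 2 / real q" "to_circle (real q * \<alpha>) = to_circle r"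
proof -
  obtain h where h: "\<bar>\<alpha> - of_int h / real q\<bar> < 1 / (real q)\<^sup>2" "0 < q"
    using assms by (auto simp: good_denominator_def)
  show thesis
  proof
    have "\<bar>real q * (real q * \<alpha>) - of_int (int q * h)\<bar> \<le> 1"
      by (rule orbit_drift[OF h]) simp
    also have "real q * (real q * \<alpha>) - of_int (int q * h) = real q * (real q * \<alpha> - of_int h)"
      by (simp add: algebra_simps)
    finally have "real q * \<bar>real q * \<alpha> - of_int h\<bar> \<le> 1"
      by (simp only: abs_mult abs_of_nat)
    then have "real q * \<bar>real q * \<alpha> - of_int h\<bar> \<le> 2" by linarith
    then show "\<bar>real q * \<alpha> - of_int h\<bar> \<le> 2 / real q"
      using h(2) by (simp add: pos_le_divide_eq mult.commute)
    show "to_circle (real q * \<alpha>) = to_circle (real q * \<alpha> - of_int h)"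
      by (simp add: to_circle_eq_iff)
  qed
qed

text \<open>
  The first \<open>q\<close> points of the orbit of \<open>x\<close> are \<open>2 / q\<close>-dense: one unit of \<open>1 / q\<close> is lost in rounding
  \<open>y - x\<close> down to a multiple of \<open>1 / q\<close>, another one in the drift of the orbit.
\<close>

lemma good_denominator_reach:
  assumes "good_denominator \<alpha> q"
  obtains j r where "j < q" "\<bar>r\<bar> \<le> 2 / real q"
    "y = x + to_circle (real j * \<alpha>) + to_circle r"
proof -
  obtain h where h: "\<bar>\<alpha> - of_int h / real q\<bar> < 1 / (real q)\<^sup>2" "0 < q" "coprime h (int q)"
    using assms by (auto simp: good_denominator_def)
  obtain u where u: "y - x = to_circle u" by (rule circle_exhaust)
  define m where "m = \<lfloor>real q * u\<rfloor>"
  have "nat (m mod int q) \<in> {..<q}"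
    using h(2) by (simp add: nat_less_iff)
  then obtain j where j: "j < q" "nat ((int j * h + 0) mod int q) = nat (m mod int q)"
    using bij_affine_mod[OF h(3,2), of 0] by (metis (no_types, lifting) bij_betw_iff_bijections lessThan_iff)
  then have "(int j * h) mod int q = m mod int q"
    using h(2) by (simp add: eq_nat_nat_iff)
  then obtain k where k: "int j * h = m + int q * k"
    by (metis mod_eqE)
  have drift: "\<bar>real q * (real j * \<alpha>) - of_int (int j * h)\<bar> < 1"
    using orbit_drift(2)[OF h(1,2) _ j(1)] j(1) by simp
  define r where "r = u - real j * \<alpha> + of_int k"
  have "real q * r = (real q * u - of_int m) - (real q * (real j * \<alpha>) - of_int (int j * h))"
    unfolding k r_def by (simp add: algebra_simps)
  moreover have "0 \<le> real q * u - of_int m" "real q * u - of_int m < 1"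
    unfolding m_def by linarith+
  ultimately have "\<bar>real q * r\<bar> \<le> 2"
    using drift by linarith
  then have "\<bar>r\<bar> \<le> 2 / real q"
    using h(2) by (simp add: abs_mult field_simps)
  moreover have "y = x + to_circle (real j * \<alpha>) + to_circle r"
  proof -
    have "to_circle u = to_circle (real j * \<alpha> + r)"
      by (simp add: to_circle_eq_iff r_def)
    then show ?thesis
      using u by (simp add: to_circle_add algebra_simps)
  qed
  ultimately show thesis using that j(1) by blast
qed

section \<open>Bounded distortion\<close>

text \<open>
  The oscillations of \<open>f\<close> over the cells \<open>[k / q, (k + 1) / q]\<close> add up to at most the variation: the points
  where the extrema over the cells are attained, two in each cell, form a single admissible chain
  of \<open>2 q\<close> points.
\<close>

lemma cell_oscillations:
  fixes f :: "circle \<Rightarrow> real"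
  assumes f: "continuous_on UNIV f" and "0 < q"
    and V: "\<And>n t. mono_on {..n} t \<Longrightarrow> t ` {..n} \<subseteq> {0..1} \<Longrightarrow>
        (\<Sum>i<n. \<bar>f (to_circle (t (Suc i))) - f (to_circle (t i))\<bar>) \<le> V"
  obtains osc :: "nat \<Rightarrow> real" where "\<And>k. 0 \<le> osc k" "(\<Sum>k<q. osc k) \<le> V"
    "\<And>k s t. s \<in> {real k / real q..(real k + 1) / real q} \<Longrightarrow>
       t \<in> {real k / real q..(real k + 1) / real q} \<Longrightarrow>
       \<bar>f (to_circle s) - f (to_circle t)\<bar> \<le> osc k"
proof -
  let ?cell = "\<lambda>k. {real k / real q..(real k + 1) / real q}"
  have ne: "?cell k \<noteq> {}" for k
    by (simp add: divide_right_mono)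
  have "\<exists>a\<in>?cell k. \<forall>s\<in>?cell k. f (to_circle a) \<le> f (to_circle s)" for k
    by (rule continuous_attains_inf[OF _ ne continuous_on_lift[OF f]]) simp
  then obtain a where a: "\<And>k. a k \<in> ?cell k"
      "\<And>k s. s \<in> ?cell k \<Longrightarrow> f (to_circle (a k)) \<le> f (to_circle s)"
    by metis
  have "\<exists>b\<in>?cell k. \<forall>s\<in>?cell k. f (to_circle s) \<le> f (to_circle b)" for k
    by (rule continuous_attains_sup[OF _ ne continuous_on_lift[OF f]]) simp
  then obtain b where b: "\<And>k. b k \<in> ?cell k"
      "\<And>k s. s \<in> ?cell k \<Longrightarrow> f (to_circle s) \<le> f (to_circle (b k))"
    by metis
  define t where "t i = (if even i then min (a (i div 2)) (b (i div 2))
      else max (a (i div 2)) (b (i div 2)))" for i :: nat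
  have cell: "t i \<in> ?cell (i div 2)" for i
    using a(1)[of "i div 2"] b(1)[of "i div 2"] by (auto simp: t_def min_def max_def)
  have "t i \<le> t (Suc i)" for i
  proof (cases "even i")
    case True
    then show ?thesis by (auto simp: t_def)
  next
    case False
    then have "Suc i div 2 = Suc (i div 2)" by presburger
    with cell[of i] cell[of "Suc i"] show ?thesis by (simp add: add.commute)
  qed
  then have mono: "mono t" by (simp add: incseq_SucI)
  define n where "n = 2 * q - 1"
  have "(\<Sum>k<q. f (to_circle (b k)) - f (to_circle (a k))) \<le>
      (\<Sum>k<q. \<bar>f (to_circle (t (Suc (2 * k)))) - f (to_circle (t (2 * k)))\<bar>)"
    by (rule sum_mono) (auto simp: t_def min_def max_def)
  also have "\<dots> = (\<Sum>i\<in>(\<lambda>k. 2 * k) ` {..<q}. \<bar>f (to_circle (t (Suc i))) - f (to_circle (t i))\<bar>)"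
    by (simp add: sum.reindex inj_on_def)
  also have "\<dots> \<le> (\<Sum>i<n. \<bar>f (to_circle (t (Suc i))) - f (to_circle (t i))\<bar>)"
    by (rule sum_mono2) (auto simp: n_def)
  also have "\<dots> \<le> V"
  proof (rule V)
    show "mono_on {..n} t" using mono by (simp add: mono_on_def monoD)
    show "t ` {..n} \<subseteq> {0..1}"
    proof
      fix y assume "y \<in> t ` {..n}"
      then obtain i where i: "i \<le> n" "y = t i" by auto
      then have "i div 2 < q" using \<open>0 < q\<close> by (auto simp: n_def)
      then have "(real (i div 2) + 1) / real q \<le> 1" by simp
      moreover have "0 \<le> real (i div 2) / real q" by simp
      ultimately show "y \<in> {0..1}"
        using cell[of i] unfolding i(2) by (simp only: atLeastAtMost_iff) linarith
    qed
  qed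
  finally have sum: "(\<Sum>k<q. f (to_circle (b k)) - f (to_circle (a k))) \<le> V" .
  show thesis
  proof (rule that[OF _ sum])
    show "0 \<le> f (to_circle (b k)) - f (to_circle (a k))" for k
      using a(2)[OF b(1), of k] by simp
    fix k s t assume st: "s \<in> ?cell k" "t \<in> ?cell k"
    show "\<bar>f (to_circle s) - f (to_circle t)\<bar> \<le> f (to_circle (b k)) - f (to_circle (a k))"
      using a(2)[OF st(1)] a(2)[OF st(2)] b(2)[OF st(1)] b(2)[OF st(2)] by linarith
  qed
qed

text \<open>
  At time \<open>j\<close> the two orbits lie in a common block of seven consecutive cells that starts \<open>j h\<close> cells
  after a fixed one. As \<open>j\<close> runs through \<open>0, \<dots>, q - 1\<close>, the block visits every cell as its \<open>d\<close>-th member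
  exactly once, for each \<open>d < 7\<close>. Comparing both points with the left end of the block costs a
  factor 2, whence the constant \<open>14 = 2 \<cdot> 7\<close>.
\<close>

lemma birkhoff_distortion:
  fixes f :: "circle \<Rightarrow> real"
  assumes f: "continuous_on UNIV f"
    and V: "\<And>n t. mono_on {..n} t \<Longrightarrow> t ` {..n} \<subseteq> {0..1} \<Longrightarrow>
        (\<Sum>i<n. \<bar>f (to_circle (t (Suc i))) - f (to_circle (t i))\<bar>) \<le> V"
    and q: "good_denominator \<alpha> q" and r: "\<bar>r\<bar> \<le> 2 / real q" and "n \<le> q"
  shows "\<bar>birkhoff \<alpha> f n (x + to_circle r) - birkhoff \<alpha> f n x\<bar> \<le> 14 * V"
proof -
  obtain h where h: "\<bar>\<alpha> - of_int h / real q\<bar> < 1 / (real q)\<^sup>2" "0 < q" "coprime h (int q)"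
    using q by (auto simp: good_denominator_def)
  obtain osc where osc: "\<And>k. 0 \<le> osc k" "(\<Sum>k<q. osc k) \<le> V"
    "\<And>k s t. s \<in> {real k / real q..(real k + 1) / real q} \<Longrightarrow>
       t \<in> {real k / real q..(real k + 1) / real q} \<Longrightarrow>
       \<bar>f (to_circle s) - f (to_circle t)\<bar> \<le> osc k"
    using cell_oscillations[OF f h(2) V] by blast
  define w where "w k = osc (nat (k mod int q))" for k :: int
  have cell: "\<bar>f (to_circle s) - f (to_circle t)\<bar> \<le> w k"
    if st: "real q * s \<in> {of_int k..of_int k + 1}" "real q * t \<in> {of_int k..of_int k + 1}"
    for s t k
  proof -
    let ?d = "of_int (k div int q) :: real"
    have k: "real (nat (k mod int q)) = of_int k - real q * ?d"
    proof -
      have "real (nat (k mod int q)) = of_int (k mod int q)"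
        using h(2) by simp
      also have "\<dots> = of_int (k - int q * (k div int q))"
        by (simp only: minus_mult_div_eq_mod)
      finally show ?thesis by (simp only: of_int_diff of_int_mult of_int_of_nat_eq)
    qed
    have shift: "s - ?d \<in> {real (nat (k mod int q)) / real q..(real (nat (k mod int q)) + 1) / real q}"
      if "real q * s \<in> {of_int k..of_int k + 1}" for s
      unfolding k using that h(2) by (simp add: field_simps)
    have "to_circle (s - ?d) = to_circle s" "to_circle (t - ?d) = to_circle t"
      by (simp_all add: to_circle_eq_iff)
    then show ?thesis
      using osc(3)[OF shift[OF st(1)] shift[OF st(2)]] by (simp add: w_def)
  qed
  have cells: "real q * s \<in> {of_int k..of_int k + real m} \<Longrightarrow>
      \<bar>f (to_circle s) - f (to_circle (of_int k / real q))\<bar> \<le> (\<Sum>d<m. w (k + int d))" for s k m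
  proof (induction m arbitrary: s)
    case 0
    then have "s = of_int k / real q" using h(2) by (simp add: field_simps)
    then show ?case by simp
  next
    case (Suc m)
    show ?case
    proof (cases "real q * s \<le> of_int k + real m")
      case True
      then have "\<bar>f (to_circle s) - f (to_circle (of_int k / real q))\<bar> \<le> (\<Sum>d<m. w (k + int d))"
        using Suc by simp
      moreover have "0 \<le> w (k + int m)" by (simp add: w_def osc(1))
      ultimately show ?thesis by simp
    next
      case False
      let ?u = "(of_int k + real m) / real q"
      have u: "real q * ?u = of_int k + real m" using h(2) by simp
      have "\<bar>f (to_circle ?u) - f (to_circle (of_int k / real q))\<bar> \<le> (\<Sum>d<m. w (k + int d))"
        by (rule Suc.IH) (simp only: u, simp)
      moreover have "\<bar>f (to_circle s) - f (to_circle ?u)\<bar> \<le> w (k + int m)"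
        by (rule cell) (use False Suc.prems u in auto)
      ultimately show ?thesis by simp
    qed
  qed
  obtain s where s: "x = to_circle s" by (rule circle_exhaust)
  (* The drift moves a point by less than one cell and r by at most two, so both orbits stay
     between 3 cells before and 4 cells after the rounded position of s. *)
  define c where "c = \<lfloor>real q * s\<rfloor> - 3"
  have step: "\<bar>f (x + to_circle r + to_circle (real j * \<alpha>)) - f (x + to_circle (real j * \<alpha>))\<bar>
      \<le> 2 * (\<Sum>d<7. w (int j * h + (c + int d)))" if j: "j < q" for j
  proof -
    have drift: "\<bar>real q * (real j * \<alpha>) - of_int (int j * h)\<bar> < 1"
      using orbit_drift(2)[OF h(1,2) _ j] j by simp
    have qr: "\<bar>real q * r\<bar> \<le> 2"
      using r h(2) by (simp add: abs_mult field_simps)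
    have c: "of_int c + 3 \<le> real q * s" "real q * s < of_int c + 4"
      unfolding c_def by linarith+
    let ?k = "int j * h + c"
    have "real q * (s + real j * \<alpha>) \<in> {of_int ?k..of_int ?k + real 7}"
         "real q * (s + r + real j * \<alpha>) \<in> {of_int ?k..of_int ?k + real 7}"
      using drift qr c unfolding distrib_left of_int_add atLeastAtMost_iff of_nat_numeral
      by linarith+
    then have "\<bar>f (to_circle (s + real j * \<alpha>)) - f (to_circle (of_int ?k / real q))\<bar> \<le> (\<Sum>d<7. w (?k + int d))"
      "\<bar>f (to_circle (s + r + real j * \<alpha>)) - f (to_circle (of_int ?k / real q))\<bar> \<le> (\<Sum>d<7. w (?k + int d))"
      by (intro cells; simp)+
    then have "\<bar>f (to_circle (s + r + real j * \<alpha>)) - f (to_circle (s + real j * \<alpha>))\<bar>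
        \<le> 2 * (\<Sum>d<7. w (?k + int d))" by linarith
    then show ?thesis by (simp add: s to_circle_add add.assoc)
  qed
  have "\<bar>birkhoff \<alpha> f n (x + to_circle r) - birkhoff \<alpha> f n x\<bar> \<le>
      (\<Sum>j<n. \<bar>f (x + to_circle r + to_circle (real j * \<alpha>)) - f (x + to_circle (real j * \<alpha>))\<bar>)"
    unfolding birkhoff_def by (simp flip: sum_subtractf) 
  also have "\<dots> \<le> (\<Sum>j<q. \<bar>f (x + to_circle r + to_circle (real j * \<alpha>)) - f (x + to_circle (real j * \<alpha>))\<bar>)"
    by (rule sum_mono2) (use \<open>n \<le> q\<close> in auto)
  also have "\<dots> \<le> (\<Sum>j<q. 2 * (\<Sum>d<7. w (int j * h + (c + int d))))"
    by (rule sum_mono) (use step in auto)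
  also have "\<dots> = 2 * (\<Sum>d<7. \<Sum>j<q. w (int j * h + (c + int d)))"
    by (subst sum.swap) (simp add: sum_distrib_left)
  also have "(\<lambda>d. \<Sum>j<q. w (int j * h + (c + int d))) = (\<lambda>d::nat. \<Sum>k<q. osc k)"
    unfolding w_def by (intro ext sum.reindex_bij_betw[OF bij_affine_mod[OF h(3,2)], of osc])
  also have "2 * (\<Sum>d<7::nat. \<Sum>k<q. osc k) \<le> 14 * V"
    using osc(2) by simp
  finally show ?thesis .
qed

text \<open>
  Passing from \<open>x\<close> to the orbit point \<open>x + j \<alpha>\<close> changes \<open>S\<^sub>q\<close> by \<open>S\<^sub>j (x + q \<alpha>) - S\<^sub>j x\<close>, and \<open>x + q \<alpha>\<close> is
  close to \<open>x\<close>. So the local hypothesis controls \<open>S\<^sub>q\<close> along an orbit segment that comes close to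
  every point.
\<close>

lemma birkhoff_oscillation:
  assumes q: "good_denominator \<alpha> q"
    and D: "\<And>n x r. n \<le> q \<Longrightarrow> \<bar>r\<bar> \<le> 2 / real q \<Longrightarrow>
        \<bar>birkhoff \<alpha> f n (x + to_circle r) - birkhoff \<alpha> f n x\<bar> \<le> D"
  shows "\<bar>birkhoff \<alpha> f q y - birkhoff \<alpha> f q x\<bar> \<le> 2 * D"
proof -
  obtain j r where j: "j < q" and r: "\<bar>r\<bar> \<le> 2 / real q"
    and y: "y = x + to_circle (real j * \<alpha>) + to_circle r"
    using good_denominator_reach[OF q] .
  obtain r' where r': "\<bar>r'\<bar> \<le> 2 / real q" "to_circle (real q * \<alpha>) = to_circle r'"
    using good_denominator_return[OF q] .
  have "birkhoff \<alpha> f q (x + to_circle (real j * \<alpha>)) - birkhoff \<alpha> f q x =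
      birkhoff \<alpha> f j (x + to_circle r') - birkhoff \<alpha> f j x"
    using birkhoff_add[of \<alpha> f q j x] birkhoff_add[of \<alpha> f j q x] r'(2)
    by (simp add: add.commute)
  then show ?thesis
    using D[OF _ r'(1), of j x] D[OF order_refl r, of "x + to_circle (real j * \<alpha>)"] j y by simp
qed

section \<open>Lebesgue measure and invariant functionals\<close>

lemma integrable_continuous_circle:
  fixes \<phi> :: "circle \<Rightarrow> real"
  assumes "finite_measure \<mu>" "sets \<mu> = sets borel" "continuous_on UNIV \<phi>"
  shows "integrable \<mu> \<phi>"
proof -
  interpret finite_measure \<mu> by fact
  obtain M where "\<And>x. \<bar>\<phi> x\<bar> \<le> M"
    using continuous_circle_bounded[OF assms(3)] by metis
  moreover have "\<phi> \<in> borel_measurable \<mu>"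
    using borel_measurable_continuous_onI[OF assms(3)] by (simp add: measurable_cong_sets[OF assms(2) refl])
  ultimately show ?thesis
    by (intro integrable_const_bound[of _ M]) auto
qed

lemma measurable_to_circle [measurable]: "to_circle \<in> borel_measurable borel"
  by (rule borel_measurable_continuous_onI[OF continuous_on_to_circle])

lemma sets_circle_lebesgue: "sets circle_lebesgue = sets borel"
  by (simp add: circle_lebesgue_def)

lemma prob_space_circle_lebesgue: "prob_space circle_lebesgue"
proof -
  have "prob_space (restrict_space lborel {0..<1::real})"
    by (rule prob_spaceI) (simp add: emeasure_restrict_space space_restrict_space)
  then show ?thesis
    unfolding circle_lebesgue_def
    by (rule prob_space.prob_space_distr) (simp add: measurable_restrict_space1)
qed

lemma integral_circle_lebesgue:
  fixes \<phi> :: "circle \<Rightarrow> real"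
  assumes [measurable]: "\<phi> \<in> borel_measurable borel"
  shows "(\<integral>x. \<phi> x \<partial>circle_lebesgue) = (\<integral>t. indicator {0..<1} t * \<phi> (to_circle t) \<partial>lborel)"
  unfolding circle_lebesgue_def
  by (subst integral_distr)
    (simp_all add: measurable_restrict_space1 integral_restrict_space)

lemma circle_lebesgue_shift:
  fixes \<phi> :: "circle \<Rightarrow> real"
  assumes \<phi>: "continuous_on UNIV \<phi>"
  shows "(\<integral>x. \<phi> (x + c) \<partial>circle_lebesgue) = (\<integral>x. \<phi> x \<partial>circle_lebesgue)"
proof -
  have [measurable]: "\<phi> \<in> borel_measurable borel"
    by (rule borel_measurable_continuous_onI[OF \<phi>])
  obtain u where u: "c = to_circle u" by (rule circle_exhaust)
  define s where "s = frac u"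
  have s: "c = to_circle s" "0 \<le> s" "s < 1"
    unfolding u s_def by (simp_all add: to_circle_eq_iff frac_lt_1) (simp add: frac_def)
  define F where "F t = \<phi> (to_circle t)" for t
  have [measurable]: "F \<in> borel_measurable borel"
    unfolding F_def by measurable
  have F1: "F (1 + t) = F t" for t
    unfolding F_def by (rule arg_cong[where f = \<phi>]) (simp add: to_circle_eq_iff)
  obtain M where M: "\<And>t. \<bar>F t\<bar> \<le> M"
    using continuous_circle_bounded[OF \<phi>] unfolding F_def by metis
  have int: "integrable lborel (\<lambda>t. indicator {a..<b} t * F t)" for a b
  proof (rule Bochner_Integration.integrable_bound)
    show "integrable lborel (\<lambda>t. M * indicator {a..<b} t :: real)"
      by (cases "a \<le> b") auto
    show "AE t in lborel. norm (indicator {a..<b} t * F t) \<le> norm (M * indicator {a..<b} t)"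
      using M by (auto simp: indicator_def intro!: AE_I2 intro: order_trans abs_ge_self)
  qed measurable
  have "(\<integral>x. \<phi> (x + c) \<partial>circle_lebesgue) = (\<integral>t. indicator {0..<1} t * F (s + t) \<partial>lborel)"
    by (subst integral_circle_lebesgue) (simp_all add: s(1) F_def to_circle_add add.commute)
  also have "\<dots> = (\<integral>t. indicator {s..<s + 1} (s + t) * F (s + t) \<partial>lborel)"
    by (rule Bochner_Integration.integral_cong) (auto simp: indicator_def)
  also have "\<dots> = (\<integral>t. indicator {s..<s + 1} t * F t \<partial>lborel)"
    using lborel_integral_real_affine[of 1 "\<lambda>t. indicator {s..<s + 1} t * F t" s] by simp
  also have "\<dots> = (\<integral>t. indicator {s..<1} t * F t + indicator {1..<s + 1} t * F t \<partial>lborel)"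
    by (rule Bochner_Integration.integral_cong) (use s in \<open>auto simp: indicator_def\<close>)
  also have "\<dots> = (\<integral>t. indicator {s..<1} t * F t \<partial>lborel) + (\<integral>t. indicator {1..<s + 1} t * F t \<partial>lborel)"
    by (rule Bochner_Integration.integral_add[OF int int])
  also have "(\<integral>t. indicator {1..<s + 1} t * F t \<partial>lborel) =
      (\<integral>t. indicator {1..<s + 1} (1 + t) * F (1 + t) \<partial>lborel)"
    using lborel_integral_real_affine[of 1 "\<lambda>t. indicator {1..<s + 1} t * F t" 1] by simp
  also have "\<dots> = (\<integral>t. indicator {0..<s} t * F t \<partial>lborel)"
    by (rule Bochner_Integration.integral_cong) (auto simp: indicator_def F1)
  also have "(\<integral>t. indicator {s..<1} t * F t \<partial>lborel) + \<dots> =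
      (\<integral>t. indicator {s..<1} t * F t + indicator {0..<s} t * F t \<partial>lborel)"
    by (rule Bochner_Integration.integral_add[symmetric, OF int int])
  also have "\<dots> = (\<integral>t. indicator {0..<1} t * F t \<partial>lborel)"
    by (rule Bochner_Integration.integral_cong) (use s in \<open>auto simp: indicator_def\<close>)
  also have "\<dots> = (\<integral>x. \<phi> x \<partial>circle_lebesgue)"
    by (simp add: integral_circle_lebesgue F_def)
  finally show ?thesis .
qed

lemmas integrable_circle_lebesgue =
  integrable_continuous_circle[OF prob_space.finite_measure[OF prob_space_circle_lebesgue]
    sets_circle_lebesgue]

lemma integral_birkhoff:
  assumes "continuous_on UNIV f"
  shows "(\<integral>x. birkhoff \<alpha> f n x \<partial>circle_lebesgue) = real n * (\<integral>x. f x \<partial>circle_lebesgue)"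
  unfolding birkhoff_def
  by (subst Bochner_Integration.integral_sum)
    (auto intro!: integrable_circle_lebesgue continuous_intros assms simp: circle_lebesgue_shift[OF assms])

lemma near_mean_of_oscillation:
  fixes g :: "circle \<Rightarrow> real"
  assumes g: "continuous_on UNIV g" and osc: "\<And>x y. \<bar>g y - g x\<bar> \<le> E"
  shows "\<bar>g x - (\<integral>y. g y \<partial>circle_lebesgue)\<bar> \<le> E"
proof -
  interpret Leb: prob_space circle_lebesgue
    by (rule prob_space_circle_lebesgue)
  have int: "integrable circle_lebesgue g"
    by (rule integrable_circle_lebesgue[OF g])
  have "(\<integral>y. g y \<partial>circle_lebesgue) \<le> (\<integral>y. g x + E \<partial>circle_lebesgue)"
    by (rule integral_mono[OF int]) (use osc[where x = x] in \<open>auto simp: abs_le_iff algebra_simps\<close>)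
  moreover have "(\<integral>y. g x - E \<partial>circle_lebesgue) \<le> (\<integral>y. g y \<partial>circle_lebesgue)"
    by (rule integral_mono[OF _ int])
      (use osc[where x = x] in \<open>auto simp: abs_le_iff algebra_simps\<close>)
  ultimately show ?thesis
    by (simp add: Leb.prob_space)
qed

text \<open>
  Only the values on continuous functions are constrained, so that an integral
  \<open>\<lambda>\<phi>. \<integral>x. g x * \<phi> x \<partial>\<mu>\<close>, a function of all \<open>\<phi>\<close>, qualifies directly.
\<close>

definition linear_functional :: "((circle \<Rightarrow> real) \<Rightarrow> real) \<Rightarrow> bool" where
  "linear_functional \<Lambda> \<longleftrightarrow> (\<forall>\<phi> \<psi> a b. continuous_on UNIV \<phi> \<longrightarrow> continuous_on UNIV \<psi> \<longrightarrow>
     \<Lambda> (\<lambda>x. a * \<phi> x + b * \<psi> x) = a * \<Lambda> \<phi> + b * \<Lambda> \<psi>)"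

definition positive_functional :: "((circle \<Rightarrow> real) \<Rightarrow> real) \<Rightarrow> bool" where
  "positive_functional \<Lambda> \<longleftrightarrow> linear_functional \<Lambda> \<and>
     (\<forall>\<phi>. continuous_on UNIV \<phi> \<longrightarrow> (\<forall>x. 0 \<le> \<phi> x) \<longrightarrow> 0 \<le> \<Lambda> \<phi>)"

lemma linear_functionalD:
  assumes "linear_functional \<Lambda>" "continuous_on UNIV \<phi>"
  shows "continuous_on UNIV \<psi> \<Longrightarrow> \<Lambda> (\<lambda>x. \<phi> x + \<psi> x) = \<Lambda> \<phi> + \<Lambda> \<psi>"
    and "continuous_on UNIV \<psi> \<Longrightarrow> \<Lambda> (\<lambda>x. \<phi> x - \<psi> x) = \<Lambda> \<phi> - \<Lambda> \<psi>"
    and "\<Lambda> (\<lambda>x. a * \<phi> x) = a * \<Lambda> \<phi>"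
proof -
  have *: "continuous_on UNIV \<psi> \<Longrightarrow> \<Lambda> (\<lambda>x. a * \<phi> x + b * \<psi> x) = a * \<Lambda> \<phi> + b * \<Lambda> \<psi>" for \<psi> a b
    using assms by (simp add: linear_functional_def)
  show "continuous_on UNIV \<psi> \<Longrightarrow> \<Lambda> (\<lambda>x. \<phi> x + \<psi> x) = \<Lambda> \<phi> + \<Lambda> \<psi>"
    using *[of \<psi> 1 1] by simp
  show "continuous_on UNIV \<psi> \<Longrightarrow> \<Lambda> (\<lambda>x. \<phi> x - \<psi> x) = \<Lambda> \<phi> - \<Lambda> \<psi>"
    using *[of \<psi> 1 "-1"] by simp
  show "\<Lambda> (\<lambda>x. a * \<phi> x) = a * \<Lambda> \<phi>"
    using *[of "\<lambda>_. 0" a 0] by simp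
qed

lemma linear_functional_sum:
  assumes \<Lambda>: "linear_functional \<Lambda>" and g: "\<And>i. continuous_on UNIV (g i)"
  shows "\<Lambda> (\<lambda>x. \<Sum>i<n. g i x) = (\<Sum>i<(n::nat). \<Lambda> (g i))"
proof (induction n)
  case 0
  show ?case using linear_functionalD(3)[OF \<Lambda>, of "\<lambda>_. 0" 0] by simp
next
  case (Suc n)
  have "\<Lambda> (\<lambda>x. (\<Sum>i<n. g i x) + g n x) = \<Lambda> (\<lambda>x. \<Sum>i<n. g i x) + \<Lambda> (g n)"
    by (rule linear_functionalD(1)[OF \<Lambda>]) (intro continuous_intros g)+
  with Suc show ?case by simp
qed

lemma positive_functional_mono:
  assumes \<Lambda>: "positive_functional \<Lambda>" and "continuous_on UNIV \<phi>" "continuous_on UNIV \<psi>"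
    and "\<And>x. \<phi> x \<le> \<psi> x"
  shows "\<Lambda> \<phi> \<le> \<Lambda> \<psi>"
proof -
  have "continuous_on UNIV (\<lambda>x. \<psi> x - \<phi> x)"
    by (intro continuous_intros assms)
  moreover have "\<forall>x. 0 \<le> \<psi> x - \<phi> x"
    using assms(4) by simp
  ultimately have "0 \<le> \<Lambda> (\<lambda>x. \<psi> x - \<phi> x)"
    using \<Lambda> by (simp add: positive_functional_def)
  also have "\<dots> = \<Lambda> \<psi> - \<Lambda> \<phi>"
    using \<Lambda> assms(2,3) by (simp add: positive_functional_def linear_functionalD(2))
  finally show ?thesis by simp
qed

lemma positive_functional_const:
  assumes "positive_functional \<Lambda>" "\<Lambda> (\<lambda>_. 1) = 1"
  shows "\<Lambda> (\<lambda>_. c) = c"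
  using linear_functionalD(3)[of \<Lambda> "\<lambda>_. 1" c] assms
  by (simp add: positive_functional_def)

lemma positive_functional_abs_le:
  assumes \<Lambda>: "positive_functional \<Lambda>" "\<Lambda> (\<lambda>_. 1) = 1" and \<phi>: "continuous_on UNIV \<phi>"
    and M: "\<And>x. \<bar>\<phi> x\<bar> \<le> M"
  shows "\<bar>\<Lambda> \<phi>\<bar> \<le> M"
proof -
  have "\<phi> x \<le> M" "- M \<le> \<phi> x" for x
    using M[of x] by linarith+
  then have "\<Lambda> \<phi> \<le> \<Lambda> (\<lambda>_. M)" "\<Lambda> (\<lambda>_. - M) \<le> \<Lambda> \<phi>"
    by (intro positive_functional_mono[OF \<Lambda>(1)] \<phi> continuous_intros; simp)+
  then show ?thesis
    by (simp add: positive_functional_const[OF \<Lambda>])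
qed

lemma positive_functional_integral:
  assumes "prob_space \<mu>" "sets \<mu> = sets borel" "continuous_on UNIV g" "\<And>x. 0 \<le> g x"
  shows "positive_functional (\<lambda>\<phi>. \<integral>x. g x * \<phi> x \<partial>\<mu>)"
proof -
  interpret prob_space \<mu> by fact
  have int: "integrable \<mu> (\<lambda>x. g x * \<phi> x)" if "continuous_on UNIV \<phi>" for \<phi>
    by (intro integrable_continuous_circle finite_measure_axioms assms continuous_intros that)
  have "(\<integral>x. g x * (a * \<phi> x + b * \<psi> x) \<partial>\<mu>) = a * (\<integral>x. g x * \<phi> x \<partial>\<mu>) + b * (\<integral>x. g x * \<psi> x \<partial>\<mu>)"
    if "continuous_on UNIV \<phi>" "continuous_on UNIV \<psi>" for \<phi> \<psi> a b
  proof -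
    have "(\<lambda>x. g x * (a * \<phi> x + b * \<psi> x)) = (\<lambda>x. a * (g x * \<phi> x) + b * (g x * \<psi> x))"
      by (auto simp: algebra_simps)
    then show ?thesis
      using int[OF that(1)] int[OF that(2)] by simp
  qed
  then show ?thesis
    using assms(4) by (auto simp: positive_functional_def linear_functional_def intro!: integral_nonneg_AE)
qed

text \<open>
  Unique ergodicity of the rotation, in a form that applies to signed invariant functionals: the
  orbit averages of \<open>\<phi>\<close> over good denominators converge to the mean uniformly, as
  \<open>birkhoff_oscillation\<close> applied to \<open>\<phi>\<close> shows, and \<open>J\<close> takes the same value on \<open>\<phi>\<close> and on its averages.
\<close>

lemma rotation_invariant_functional:
  assumes \<alpha>: "\<alpha> \<notin> \<rat>" and J: "linear_functional J"
    and bound: "\<And>\<phi> M. continuous_on UNIV \<phi> \<Longrightarrow> (\<And>x. \<bar>\<phi> x\<bar> \<le> M) \<Longrightarrow> \<bar>J \<phi>\<bar> \<le> M"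
    and inv: "\<And>\<phi>. continuous_on UNIV \<phi> \<Longrightarrow> J (\<lambda>x. \<phi> (x + to_circle \<alpha>)) = J \<phi>"
    and \<phi>: "continuous_on UNIV \<phi>"
  shows "J \<phi> = J (\<lambda>_. 1) * (\<integral>x. \<phi> x \<partial>circle_lebesgue)"
proof -
  let ?m = "\<integral>x. \<phi> x \<partial>circle_lebesgue"
  have "\<bar>J \<phi> - J (\<lambda>_. 1) * ?m\<bar> \<le> e" if "0 < e" for e
  proof -
    obtain \<delta> where \<delta>: "0 < \<delta>" "\<And>x r. \<bar>r\<bar> \<le> \<delta> \<Longrightarrow> \<bar>\<phi> (x + to_circle r) - \<phi> x\<bar> \<le> e / 2"
      using continuous_circle_uniform[OF \<phi>, of "e / 2"] \<open>0 < e\<close> by auto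
    obtain q where q: "nat \<lceil>2 / \<delta>\<rceil> < q" "good_denominator \<alpha> q"
      using unbounded_good_denominators[OF \<alpha>] .
    have q0: "0 < real q" using q(1) by simp
    have "2 / \<delta> \<le> real q" using q(1) by linarith
    then have q\<delta>: "2 / real q \<le> \<delta>"
      using \<delta>(1) q0 by (simp add: field_simps)
    (* Uniform continuity alone gives distortion at most q e / 2; dividing by q makes it small. *)
    have dist: "\<bar>birkhoff \<alpha> \<phi> n (x + to_circle r) - birkhoff \<alpha> \<phi> n x\<bar> \<le> real q * (e / 2)"
      if "n \<le> q" "\<bar>r\<bar> \<le> 2 / real q" for n x r
    proof -
      have "\<bar>birkhoff \<alpha> \<phi> n (x + to_circle r) - birkhoff \<alpha> \<phi> n x\<bar> \<le>
          (\<Sum>i<n. \<bar>\<phi> (x + to_circle r + to_circle (real i * \<alpha>)) - \<phi> (x + to_circle (real i * \<alpha>))\<bar>)"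
        unfolding birkhoff_def by (simp flip: sum_subtractf)
      also have "\<dots> \<le> (\<Sum>i<n. e / 2)"
      proof (rule sum_mono)
        fix i
        have "x + to_circle r + to_circle (real i * \<alpha>) = x + to_circle (real i * \<alpha>) + to_circle r"
          by (simp add: algebra_simps)
        then show "\<bar>\<phi> (x + to_circle r + to_circle (real i * \<alpha>)) - \<phi> (x + to_circle (real i * \<alpha>))\<bar> \<le> e / 2"
          using \<delta>(2)[of r] that(2) q\<delta> by (metis order_trans)
      qed
      also have "\<dots> \<le> real q * (e / 2)"
        using that(1) \<open>0 < e\<close> by simp
      finally show ?thesis .
    qed
    have cS: "continuous_on UNIV (birkhoff \<alpha> \<phi> q)"
      by (intro continuous_intros \<phi>)
    have "\<bar>birkhoff \<alpha> \<phi> q y - birkhoff \<alpha> \<phi> q x\<bar> \<le> real q * e" for x y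
      using birkhoff_oscillation[OF q(2) dist, of y x] by simp
    then have "\<bar>birkhoff \<alpha> \<phi> q x - real q * ?m\<bar> \<le> real q * e" for x
      using near_mean_of_oscillation[OF cS, of "real q * e" x] by (simp add: integral_birkhoff[OF \<phi>])
    then have "\<bar>J (\<lambda>x. birkhoff \<alpha> \<phi> q x - real q * ?m)\<bar> \<le> real q * e"
      by (intro bound continuous_intros cS) 
    moreover have "J (\<lambda>x. birkhoff \<alpha> \<phi> q x - real q * ?m) = real q * (J \<phi> - J (\<lambda>_. 1) * ?m)"
    proof -
      have orbit: "J (\<lambda>x. \<phi> (x + to_circle (real i * \<alpha>))) = J \<phi>" for i
      proof (induction i)
        case (Suc i)
        have "J (\<lambda>x. \<phi> (x + to_circle \<alpha> + to_circle (real i * \<alpha>))) = J (\<lambda>x. \<phi> (x + to_circle (real i * \<alpha>)))"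
          by (rule inv) (intro continuous_intros \<phi>)
        then show ?case
          using Suc by (simp add: algebra_simps to_circle_add)
      qed simp
      have "J (birkhoff \<alpha> \<phi> q) = real q * J \<phi>"
        unfolding birkhoff_def[abs_def]
        by (subst linear_functional_sum[OF J]) (auto intro!: continuous_intros \<phi> simp: orbit)
      moreover have "J (\<lambda>_. real q * ?m) = real q * ?m * J (\<lambda>_. 1)"
        using linear_functionalD(3)[OF J, of "\<lambda>_. 1" "real q * ?m"] by simp
      moreover have "J (\<lambda>x. birkhoff \<alpha> \<phi> q x - real q * ?m) = J (birkhoff \<alpha> \<phi> q) - J (\<lambda>_. real q * ?m)"
        by (rule linear_functionalD(2)[OF J cS]) (intro continuous_intros)
      ultimately show ?thesis by (simp add: algebra_simps)
    qed
    ultimately show ?thesis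
      using q0 by (simp add: abs_mult)
  qed
  then have "\<bar>J \<phi> - J (\<lambda>_. 1) * ?m\<bar> \<le> 0"
    by (rule field_le_epsilon) simp
  then show ?thesis by simp
qed

section \<open>The current of a stationary measure vanishes\<close>

text \<open>
  What the argument uses of irrationality, symmetry and bounded variation, with \<open>f\<close>
  in the role of \<open>ln (p / q)\<close>.
\<close>

locale tame_cocycle =
  fixes \<alpha> D :: real and f :: "circle \<Rightarrow> real"
  assumes irrational: "\<alpha> \<notin> \<rat>"
    and continuous_f: "continuous_on UNIV f"
    and mean_f: "(\<integral>x. f x \<partial>circle_lebesgue) = 0"
    and distortion: "\<And>q n x r. good_denominator \<alpha> q \<Longrightarrow> n \<le> q \<Longrightarrow> \<bar>r\<bar> \<le> 2 / real q \<Longrightarrow>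
        \<bar>birkhoff \<alpha> f n (x + to_circle r) - birkhoff \<alpha> f n x\<bar> \<le> D"
begin

lemmas [continuous_intros] = continuous_f

lemma D_nonneg: "0 \<le> D"
proof -
  obtain q where "good_denominator \<alpha> q"
    using unbounded_good_denominators[OF irrational, of 0] by blast
  from distortion[OF this, of 0 0] show ?thesis by simp
qed

lemma birkhoff_good_denominator:
  assumes "good_denominator \<alpha> q"
  shows "\<bar>birkhoff \<alpha> f q x\<bar> \<le> 2 * D"
  using near_mean_of_oscillation[OF continuous_on_birkhoff[OF continuous_f]
      birkhoff_oscillation[OF assms distortion[OF assms]], of x]
  by (simp add: integral_birkhoff[OF continuous_f] mean_f)

text \<open>
  Jensen's inequality for the exponential, through its tangent at \<open>0\<close>.
\<close>

lemma integral_exp_birkhoff_ge_1: "1 \<le> (\<integral>x. exp (birkhoff \<alpha> f n x) \<partial>circle_lebesgue)"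
proof -
  interpret Leb: prob_space circle_lebesgue
    by (rule prob_space_circle_lebesgue)
  have int: "integrable circle_lebesgue (birkhoff \<alpha> f n)"
    by (intro integrable_circle_lebesgue continuous_intros)
  have "1 = (\<integral>x. 1 + birkhoff \<alpha> f n x \<partial>circle_lebesgue)"
    using int by (simp add: integral_birkhoff[OF continuous_f] mean_f Leb.prob_space)
  also have "\<dots> \<le> (\<integral>x. exp (birkhoff \<alpha> f n x) \<partial>circle_lebesgue)"
  proof (rule integral_mono)
    show "integrable circle_lebesgue (\<lambda>x. exp (birkhoff \<alpha> f n x))"
      by (intro integrable_circle_lebesgue continuous_intros)
  qed (use int in \<open>auto simp: exp_ge_add_one_self\<close>)
  finally show ?thesis .
qed

text \<open>
  The dual of the operator \<open>\<nu> \<mapsto> T\<^sub>*(exp f \<nu>)\<close> on measures; its \<open>n\<close>-th power sends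
  \<open>\<phi>\<close> to \<open>exp S\<^sub>n\<close> times \<open>\<phi> \<circ> T\<^sup>n\<close>.
\<close>

definition transfer :: "(circle \<Rightarrow> real) \<Rightarrow> circle \<Rightarrow> real" where
  "transfer \<phi> x = exp (f x) * \<phi> (x + to_circle \<alpha>)"

lemma continuous_on_transfer [continuous_intros]:
  "continuous_on UNIV \<phi> \<Longrightarrow> continuous_on UNIV (transfer \<phi>)"
  unfolding transfer_def[abs_def] by (intro continuous_intros)

lemma transfer_exp_birkhoff:
  "transfer (\<lambda>x. exp (birkhoff \<alpha> f n x)) = (\<lambda>x. exp (birkhoff \<alpha> f (Suc n) x))"
  by (simp add: transfer_def fun_eq_iff birkhoff_Suc exp_add)

text \<open>
  A positive functional cannot gain or lose a multiple of Lebesgue measure at each application of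
  the transfer operator: the gains only accumulate, each having mass at least \<open>1\<close>, whereas
  the total mass at good denominators stays between \<open>0\<close> and \<open>exp (2 D)\<close>.
\<close>

lemma current_vanishes:
  assumes \<Lambda>: "positive_functional \<Lambda>" "\<Lambda> (\<lambda>_. 1) \<le> 1"
    and flux: "\<And>\<phi>. continuous_on UNIV \<phi> \<Longrightarrow> \<Lambda> (transfer \<phi>) = \<Lambda> \<phi> + c * (\<integral>x. \<phi> x \<partial>circle_lebesgue)"
  shows "c = 0"
proof -
  let ?E = "\<lambda>n x. exp (birkhoff \<alpha> f n x)"
  have lin: "linear_functional \<Lambda>" using \<Lambda>(1) by (simp add: positive_functional_def)
  have cE: "continuous_on UNIV (?E n)" for n
    by (intro continuous_intros)
  have iterate: "\<Lambda> (?E n) = \<Lambda> (\<lambda>_. 1) + c * (\<Sum>k<n. \<integral>x. ?E k x \<partial>circle_lebesgue)" for n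
  proof (induction n)
    case (Suc n)
    have "\<Lambda> (?E (Suc n)) = \<Lambda> (?E n) + c * (\<integral>x. ?E n x \<partial>circle_lebesgue)"
      using flux[OF cE] by (simp add: transfer_exp_birkhoff)
    with Suc show ?case by (simp add: algebra_simps)
  qed simp
  have mass: "real n \<le> (\<Sum>k<n. \<integral>x. ?E k x \<partial>circle_lebesgue)" for n
    using sum_mono[of "{..<n}" "\<lambda>_. 1" "\<lambda>k. \<integral>x. ?E k x \<partial>circle_lebesgue"] integral_exp_birkhoff_ge_1
    by simp
  have nonneg: "0 \<le> \<Lambda> (?E n)" for n
    using \<Lambda>(1) cE by (simp add: positive_functional_def)
  have nonneg1: "0 \<le> \<Lambda> (\<lambda>_. 1)"
    using nonneg[of 0] by simp
  have bound: "\<bar>c\<bar> * real q \<le> exp (2 * D)" if q: "good_denominator \<alpha> q" for q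
  proof (cases "0 \<le> c")
    case True
    have "?E q x \<le> exp (2 * D)" for x
      using birkhoff_good_denominator[OF q, of x] by simp
    then have "\<Lambda> (?E q) \<le> \<Lambda> (\<lambda>_. exp (2 * D))"
      by (intro positive_functional_mono[OF \<Lambda>(1)] cE continuous_intros)
    also have "\<dots> = exp (2 * D) * \<Lambda> (\<lambda>_. 1)"
      using linear_functionalD(3)[OF lin, of "\<lambda>_. 1" "exp (2 * D)"] by simp
    also have "\<dots> \<le> exp (2 * D)"
      using \<Lambda>(2) by simp
    finally have "c * (\<Sum>k<q. \<integral>x. ?E k x \<partial>circle_lebesgue) \<le> exp (2 * D)"
      using iterate[of q] nonneg1 by simp
    with mult_left_mono[OF mass True, of q] True show ?thesis by simp
  next
    case False
    have "- c * (\<Sum>k<q. \<integral>x. ?E k x \<partial>circle_lebesgue) \<le> 1"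
      using iterate[of q] nonneg[of q] \<Lambda>(2) by simp
    moreover have "- c * real q \<le> - c * (\<Sum>k<q. \<integral>x. ?E k x \<partial>circle_lebesgue)"
      by (rule mult_left_mono[OF mass]) (use False in simp)
    moreover have "1 \<le> exp (2 * D)" using D_nonneg by simp
    ultimately have "- c * real q \<le> exp (2 * D)" by linarith
    then show ?thesis using False by simp
  qed
  show "c = 0"
  proof (rule ccontr)
    assume "c \<noteq> 0"
    obtain q where q: "nat \<lceil>exp (2 * D) / \<bar>c\<bar>\<rceil> < q" "good_denominator \<alpha> q"
      using unbounded_good_denominators[OF irrational] .
    then have "exp (2 * D) / \<bar>c\<bar> < real q" by linarith
    then have "exp (2 * D) < \<bar>c\<bar> * real q"
      using \<open>c \<noteq> 0\<close> by (simp add: field_simps)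
    with bound[OF q(2)] show False by simp
  qed
qed

section \<open>Uniqueness of the conformal functional\<close>

definition orbit_sum :: "nat \<Rightarrow> (circle \<Rightarrow> real) \<Rightarrow> circle \<Rightarrow> real" where
  "orbit_sum n \<phi> x = (\<Sum>i<n. exp (birkhoff \<alpha> f i x) * \<phi> (x + to_circle (real i * \<alpha>)))"

lemma continuous_on_orbit_sum [continuous_intros]:
  "continuous_on UNIV \<phi> \<Longrightarrow> continuous_on UNIV (orbit_sum n \<phi>)"
  unfolding orbit_sum_def[abs_def] by (intro continuous_intros)

lemma orbit_sum_Suc: "orbit_sum (Suc n) \<phi> x = \<phi> x + transfer (orbit_sum n \<phi>) x"
  unfolding orbit_sum_def transfer_def
  by (simp add: sum.lessThan_Suc_shift sum_distrib_left birkhoff_Suc exp_add to_circle_add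
      algebra_simps del: sum.lessThan_Suc)

text \<open>
  If \<open>y\<close> is close to the \<open>j\<close>-th orbit point of \<open>x\<close>, then the \<open>i\<close>-th orbit point of \<open>y\<close> is close to the point
  with index \<open>i + j\<close> of \<open>x\<close>, and when this index exceeds \<open>q\<close> the near-return at time \<open>q\<close> lets one replace it
  by \<open>i + j - q\<close>. The weights match up to the common factor \<open>exp (S\<^sub>j x)\<close>: closeness of \<open>y\<close> costs \<open>D\<close> in
  the exponent, and dropping \<open>q\<close> steps costs \<open>2 D\<close> for \<open>S\<^sub>q\<close> and \<open>D\<close> for the near-return.
\<close>

lemma orbit_point_match:
  assumes q: "good_denominator \<alpha> q" and j: "j < q" and i: "i < q" and r: "\<bar>r\<bar> \<le> 2 / real q"
    and y: "y = x + to_circle (real j * \<alpha>) + to_circle r"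
  defines "k \<equiv> (i + j) mod q"
  shows "\<bar>birkhoff \<alpha> f i y - (birkhoff \<alpha> f k x - birkhoff \<alpha> f j x)\<bar> \<le> 4 * D"
    and "\<exists>r r'. \<bar>r\<bar> \<le> 2 / real q \<and> \<bar>r'\<bar> \<le> 2 / real q \<and>
       y + to_circle (real i * \<alpha>) = x + to_circle (real k * \<alpha>) + to_circle r + to_circle r'"
proof -
  obtain r' where r': "\<bar>r'\<bar> \<le> 2 / real q" "to_circle (real q * \<alpha>) = to_circle r'"
    using good_denominator_return[OF q] .
  have near: "\<bar>birkhoff \<alpha> f i y - (birkhoff \<alpha> f (i + j) x - birkhoff \<alpha> f j x)\<bar> \<le> D"
    using distortion[OF q _ r, of i "x + to_circle (real j * \<alpha>)"] i birkhoff_add[of \<alpha> f j i x] y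
    by (simp add: add.commute)
  have pt: "y + to_circle (real i * \<alpha>) = x + to_circle (real (i + j) * \<alpha>) + to_circle r"
    by (simp add: y algebra_simps to_circle_add)
  have "\<bar>birkhoff \<alpha> f i y - (birkhoff \<alpha> f k x - birkhoff \<alpha> f j x)\<bar> \<le> 4 * D \<and>
    (\<exists>r r'. \<bar>r\<bar> \<le> 2 / real q \<and> \<bar>r'\<bar> \<le> 2 / real q \<and>
       y + to_circle (real i * \<alpha>) = x + to_circle (real k * \<alpha>) + to_circle r + to_circle r')"
  proof (cases "i + j < q")
    case True
    then have k: "k = i + j" by (simp add: k_def)
    show ?thesis
      using near D_nonneg pt r unfolding k by (intro conjI exI[of _ r] exI[of _ 0]) auto
  next
    case False
    then have k: "i + j = q + k" "k \<le> q"
      using i j by (auto simp: k_def le_mod_geq)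
    have "\<bar>birkhoff \<alpha> f (i + j) x - birkhoff \<alpha> f k x\<bar> \<le> 3 * D"
      using birkhoff_add[of \<alpha> f q k x] birkhoff_good_denominator[OF q, of x]
        distortion[OF q k(2) r'(1), of x] r'(2) unfolding k(1) by simp
    moreover have "y + to_circle (real i * \<alpha>) = x + to_circle (real k * \<alpha>) + to_circle r + to_circle r'"
      unfolding pt k(1) using r'(2) by (simp add: algebra_simps to_circle_add)
    ultimately show ?thesis
      using near r r'(1) by (intro conjI exI[of _ r] exI[of _ r']) auto
  qed
  then show "\<bar>birkhoff \<alpha> f i y - (birkhoff \<alpha> f k x - birkhoff \<alpha> f j x)\<bar> \<le> 4 * D"
    and "\<exists>r r'. \<bar>r\<bar> \<le> 2 / real q \<and> \<bar>r'\<bar> \<le> 2 / real q \<and>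
       y + to_circle (real i * \<alpha>) = x + to_circle (real k * \<alpha>) + to_circle r + to_circle r'"
    by blast+
qed

text \<open>
  The weighted means \<open>orbit_sum q \<phi> / orbit_sum q 1\<close> from any two starting points are comparable: the
  cyclic shift by \<open>j\<close> pairs their terms. The unknown factor \<open>exp (S\<^sub>j x)\<close> cancels in the quotient; the
  statement is multiplied out so that a linear functional can be applied to each variable.
\<close>

lemma orbit_sum_comparison:
  assumes q: "good_denominator \<alpha> q" and nonneg: "\<And>x. 0 \<le> \<phi> x" "0 \<le> \<epsilon>"
    and \<phi>: "\<And>x r. \<bar>r\<bar> \<le> 2 / real q \<Longrightarrow> \<bar>\<phi> (x + to_circle r) - \<phi> x\<bar> \<le> \<epsilon>"
  shows "orbit_sum q \<phi> y * orbit_sum q (\<lambda>_. 1) x \<le>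
    exp (8 * D) * (orbit_sum q \<phi> x + 2 * \<epsilon> * orbit_sum q (\<lambda>_. 1) x) * orbit_sum q (\<lambda>_. 1) y"
proof -
  obtain j r where j: "j < q" and r: "\<bar>r\<bar> \<le> 2 / real q"
    and y: "y = x + to_circle (real j * \<alpha>) + to_circle r"
    using good_denominator_reach[OF q] .
  define k where "k i = (i + j) mod q" for i
  define b where "b = birkhoff \<alpha> f j x"
  define u where "u i = exp (birkhoff \<alpha> f i x)" for i
  have "bij_betw k {..<q} {..<q}"
  proof -
    have "0 < q" using j by simp
    have "(\<lambda>i. nat ((int i * 1 + int j) mod int q)) = k"
      by (auto simp: k_def fun_eq_iff nat_mod_distrib nat_add_distrib)
    with bij_affine_mod[of 1 q "int j"] \<open>0 < q\<close> show ?thesis by simp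
  qed
  note reindex = sum.reindex_bij_betw[OF this]
  note match = orbit_point_match[OF q j _ r y, folded k_def b_def]
  have weight: "exp (birkhoff \<alpha> f i y) \<le> exp (4 * D - b) * u (k i)"
    "u (k i) \<le> exp (4 * D + b) * exp (birkhoff \<alpha> f i y)" if "i < q" for i
    using match(1)[OF that] by (simp_all add: u_def abs_le_iff flip: exp_add)
  have near_value: "\<phi> (y + to_circle (real i * \<alpha>)) \<le> \<phi> (x + to_circle (real (k i) * \<alpha>)) + 2 * \<epsilon>"
    if i: "i < q" for i
  proof -
    obtain r r' where *: "\<bar>r\<bar> \<le> 2 / real q" "\<bar>r'\<bar> \<le> 2 / real q"
      "y + to_circle (real i * \<alpha>) = x + to_circle (real (k i) * \<alpha>) + to_circle r + to_circle r'"
      using match(2)[OF i] by blast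
    show ?thesis
      using \<phi>[OF *(1), of "x + to_circle (real (k i) * \<alpha>)"]
        \<phi>[OF *(2), of "x + to_circle (real (k i) * \<alpha>) + to_circle r"] *(3) by simp
  qed
  have "orbit_sum q \<phi> y \<le>
      (\<Sum>i<q. exp (4 * D - b) * u (k i) * (\<phi> (x + to_circle (real (k i) * \<alpha>)) + 2 * \<epsilon>))"
    unfolding orbit_sum_def
    by (intro sum_mono mult_mono weight near_value) (auto simp: u_def nonneg)
  also have "\<dots> = (\<Sum>i<q. exp (4 * D - b) * u i * (\<phi> (x + to_circle (real i * \<alpha>)) + 2 * \<epsilon>))"
    by (rule reindex)
  also have "\<dots> = exp (4 * D - b) * (orbit_sum q \<phi> x + 2 * \<epsilon> * orbit_sum q (\<lambda>_. 1) x)"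
    by (simp add: orbit_sum_def u_def sum_distrib_left sum.distrib algebra_simps)
  finally have up: "orbit_sum q \<phi> y \<le> exp (4 * D - b) * (orbit_sum q \<phi> x + 2 * \<epsilon> * orbit_sum q (\<lambda>_. 1) x)" .
  have "orbit_sum q (\<lambda>_. 1) x = (\<Sum>i<q. u (k i))"
    unfolding orbit_sum_def u_def using reindex[of "\<lambda>i. exp (birkhoff \<alpha> f i x)"] by simp
  also have "\<dots> \<le> (\<Sum>i<q. exp (4 * D + b) * exp (birkhoff \<alpha> f i y))"
    by (rule sum_mono) (use weight in auto)
  also have "\<dots> = exp (4 * D + b) * orbit_sum q (\<lambda>_. 1) y"
    by (simp add: orbit_sum_def sum_distrib_left)
  finally have low: "orbit_sum q (\<lambda>_. 1) x \<le> exp (4 * D + b) * orbit_sum q (\<lambda>_. 1) y" .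
  have pos: "0 \<le> orbit_sum q \<psi> z" if "\<And>x. 0 \<le> \<psi> x" for \<psi> z
    unfolding orbit_sum_def by (intro sum_nonneg mult_nonneg_nonneg that) simp
  have "orbit_sum q \<phi> y * orbit_sum q (\<lambda>_. 1) x \<le>
      (exp (4 * D - b) * (orbit_sum q \<phi> x + 2 * \<epsilon> * orbit_sum q (\<lambda>_. 1) x)) *
      (exp (4 * D + b) * orbit_sum q (\<lambda>_. 1) y)"
    by (intro mult_mono up low mult_nonneg_nonneg add_nonneg_nonneg pos nonneg) auto
  also have "\<dots> = (exp (4 * D - b) * exp (4 * D + b)) *
      (orbit_sum q \<phi> x + 2 * \<epsilon> * orbit_sum q (\<lambda>_. 1) x) * orbit_sum q (\<lambda>_. 1) y"
    by (simp add: algebra_simps)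
  also have "exp (4 * D - b) * exp (4 * D + b) = exp (8 * D)"
    by (simp flip: exp_add)
  finally show ?thesis .
qed

definition conformal :: "((circle \<Rightarrow> real) \<Rightarrow> real) \<Rightarrow> bool" where
  "conformal \<Lambda> \<longleftrightarrow> positive_functional \<Lambda> \<and> \<Lambda> (\<lambda>_. 1) = 1 \<and>
     (\<forall>\<phi>. continuous_on UNIV \<phi> \<longrightarrow> \<Lambda> (transfer \<phi>) = \<Lambda> \<phi>)"

lemma conformal_orbit_sum:
  assumes \<Lambda>: "conformal \<Lambda>" and \<phi>: "continuous_on UNIV \<phi>"
  shows "\<Lambda> (orbit_sum n \<phi>) = real n * \<Lambda> \<phi>"
proof (induction n)
  have lin: "linear_functional \<Lambda>"
    using \<Lambda> by (simp add: conformal_def positive_functional_def)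
  case 0
  show ?case
    using linear_functionalD(3)[OF lin, of "\<lambda>_. 0" 0] by (simp add: orbit_sum_def[abs_def])
next
  have lin: "linear_functional \<Lambda>"
    using \<Lambda> by (simp add: conformal_def positive_functional_def)
  case (Suc n)
  have "\<Lambda> (orbit_sum (Suc n) \<phi>) = \<Lambda> \<phi> + \<Lambda> (transfer (orbit_sum n \<phi>))"
    unfolding orbit_sum_Suc[abs_def]
    by (rule linear_functionalD(1)[OF lin \<phi>]) (intro continuous_intros \<phi>)
  also have "\<Lambda> (transfer (orbit_sum n \<phi>)) = \<Lambda> (orbit_sum n \<phi>)"
    using \<Lambda> continuous_on_orbit_sum[OF \<phi>] by (simp add: conformal_def)
  finally show ?case
    using Suc by (simp add: algebra_simps)
qed

text \<open>
  Conformality gives \<open>\<Lambda> (orbit_sum q \<phi>) = q \<Lambda> \<phi>\<close> for every \<open>q\<close>. So applying \<open>\<Lambda>\<close> in \<open>y\<close> and \<open>\<Lambda>'\<close> in \<open>x\<close> to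
  \<open>orbit_sum_comparison\<close> replaces the orbit sums by \<open>\<Lambda> \<phi>\<close> and \<open>\<Lambda>' \<phi>\<close>; the error vanishes as \<open>q \<rightarrow> \<infinity>\<close>.
\<close>

lemma conformal_comparison:
  assumes \<Lambda>: "conformal \<Lambda>" and \<Lambda>': "conformal \<Lambda>'"
    and \<phi>: "continuous_on UNIV \<phi>" "\<And>x. 0 \<le> \<phi> x"
  shows "\<Lambda> \<phi> \<le> exp (8 * D) * \<Lambda>' \<phi>"
proof (rule field_le_epsilon)
  fix e :: real assume "0 < e"
  define \<epsilon> where "\<epsilon> = e / (2 * exp (8 * D))"
  have "0 < \<epsilon>" using \<open>0 < e\<close> by (simp add: \<epsilon>_def)
  obtain \<delta> where \<delta>: "0 < \<delta>" "\<And>x r. \<bar>r\<bar> \<le> \<delta> \<Longrightarrow> \<bar>\<phi> (x + to_circle r) - \<phi> x\<bar> \<le> \<epsilon>"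
    using continuous_circle_uniform[OF \<phi>(1) \<open>0 < \<epsilon>\<close>] by auto
  obtain q where q: "nat \<lceil>2 / \<delta>\<rceil> < q" "good_denominator \<alpha> q"
    using unbounded_good_denominators[OF irrational] .
  have q0: "0 < real q" using q(1) by simp
  have "2 / \<delta> \<le> real q" using q(1) by linarith
  then have "2 / real q \<le> \<delta>"
    using \<delta>(1) q0 by (simp add: field_simps)
  then have \<phi>\<epsilon>: "\<bar>r\<bar> \<le> 2 / real q \<Longrightarrow> \<bar>\<phi> (x + to_circle r) - \<phi> x\<bar> \<le> \<epsilon>" for x r
    using \<delta>(2)[of r x] by simp
  let ?N = "orbit_sum q \<phi>" and ?W = "orbit_sum q (\<lambda>_. 1)"
  have cN: "continuous_on UNIV ?N" and cW: "continuous_on UNIV ?W"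
    by (intro continuous_intros \<phi>)+
  have pos: "positive_functional \<Lambda>" "positive_functional \<Lambda>'"
    and lin: "linear_functional \<Lambda>" "linear_functional \<Lambda>'"
    using \<Lambda> \<Lambda>' by (simp_all add: conformal_def positive_functional_def)
  have W: "\<Lambda> ?W = real q" "\<Lambda>' ?W = real q"
    using conformal_orbit_sum[OF \<Lambda>, of "\<lambda>_. 1" q] conformal_orbit_sum[OF \<Lambda>', of "\<lambda>_. 1" q] \<Lambda> \<Lambda>'
    by (simp_all add: conformal_def)
  have "\<Lambda> \<phi> * ?W x \<le> exp (8 * D) * (?N x + 2 * \<epsilon> * ?W x)" for x
  proof -
    let ?c = "exp (8 * D) * (?N x + 2 * \<epsilon> * ?W x)"
    have "?W x * ?N y \<le> ?c * ?W y" for y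
      using orbit_sum_comparison[OF q(2) \<phi>(2) less_imp_le[OF \<open>0 < \<epsilon>\<close>] \<phi>\<epsilon>, of y x]
      by (simp only: mult.commute[of "?W x" "?N y"])
    then have "\<Lambda> (\<lambda>y. ?W x * ?N y) \<le> \<Lambda> (\<lambda>y. ?c * ?W y)"
      by (intro positive_functional_mono[OF pos(1)] continuous_on_mult continuous_on_const cN cW)
    also have "\<Lambda> (\<lambda>y. ?W x * ?N y) = ?W x * (real q * \<Lambda> \<phi>)"
      by (simp only: linear_functionalD(3)[OF lin(1) cN] conformal_orbit_sum[OF \<Lambda> \<phi>(1)])
    also have "\<Lambda> (\<lambda>y. ?c * ?W y) = ?c * real q"
      by (simp only: linear_functionalD(3)[OF lin(1) cW] W)
    finally have "real q * (\<Lambda> \<phi> * ?W x) \<le> real q * ?c"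
      by (simp only: mult_ac)
    then show ?thesis
      using q0 by (simp only: mult_le_cancel_left_pos)
  qed
  then have "\<Lambda>' (\<lambda>x. \<Lambda> \<phi> * ?W x) \<le> \<Lambda>' (\<lambda>x. exp (8 * D) * (?N x + 2 * \<epsilon> * ?W x))"
    by (intro positive_functional_mono[OF pos(2)] continuous_on_add continuous_on_mult continuous_on_const cN cW)
  also have "\<dots> = exp (8 * D) * (\<Lambda>' ?N + 2 * \<epsilon> * \<Lambda>' ?W)"
  proof -
    have "\<Lambda>' (\<lambda>x. exp (8 * D) * (?N x + 2 * \<epsilon> * ?W x)) = exp (8 * D) * \<Lambda>' (\<lambda>x. ?N x + 2 * \<epsilon> * ?W x)"
      by (intro linear_functionalD(3)[OF lin(2)] continuous_on_add continuous_on_mult continuous_on_const cN cW)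
    also have "\<Lambda>' (\<lambda>x. ?N x + 2 * \<epsilon> * ?W x) = \<Lambda>' ?N + \<Lambda>' (\<lambda>x. 2 * \<epsilon> * ?W x)"
      by (intro linear_functionalD(1)[OF lin(2)] continuous_on_add continuous_on_mult continuous_on_const cN cW)
    finally show ?thesis
      by (simp only: linear_functionalD(3)[OF lin(2) cW])
  qed
  finally have "real q * \<Lambda> \<phi> \<le> real q * (exp (8 * D) * (\<Lambda>' \<phi> + 2 * \<epsilon>))"
    unfolding linear_functionalD(3)[OF lin(2) cW] W conformal_orbit_sum[OF \<Lambda>' \<phi>(1)]
    by (simp add: algebra_simps)
  then have "\<Lambda> \<phi> \<le> exp (8 * D) * (\<Lambda>' \<phi> + 2 * \<epsilon>)"
    using q0 by (simp only: mult_le_cancel_left_pos)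
  also have "\<dots> = exp (8 * D) * \<Lambda>' \<phi> + e"
    by (simp add: \<epsilon>_def field_simps)
  finally show "\<Lambda> \<phi> \<le> exp (8 * D) * \<Lambda>' \<phi> + e" .
qed

text \<open>
  Since the comparison constant is the same for all conformal functionals, it can be applied again
  to the normalised remainder \<open>\<Gamma>\<close> of \<open>\<Lambda>\<close> after subtraction of a multiple of \<open>\<Lambda>'\<close>. Each round removes a
  fixed proportion of the remaining mass, so the multiple tends to \<open>1\<close>.
\<close>

lemma conformal_dominates:
  assumes \<Lambda>: "conformal \<Lambda>" and \<Lambda>': "conformal \<Lambda>'"
    and \<phi>: "continuous_on UNIV \<phi>" "\<And>x. 0 \<le> \<phi> x"
  shows "\<Lambda>' \<phi> \<le> \<Lambda> \<phi>"
proof -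
  (* Halving the comparison constant keeps a positive even when D = 0. *)
  define a where "a = 1 - exp (- (8 * D)) / 2"
  have a: "0 < a" "a < 1"
    using exp_le_one_iff[of "- (8 * D)"] D_nonneg exp_gt_zero[of "- (8 * D)"] unfolding a_def
    by linarith+
  have lin: "linear_functional \<Lambda>" "linear_functional \<Lambda>'"
    using \<Lambda> \<Lambda>' by (simp_all add: conformal_def positive_functional_def)
  have geometric: "(1 - a ^ n) * \<Lambda>' \<psi> \<le> \<Lambda> \<psi>"
    if "continuous_on UNIV \<psi>" "\<And>x. 0 \<le> \<psi> x" for \<psi> n
    using that
  proof (induction n arbitrary: \<psi>)
    case 0
    then show ?case using \<Lambda> by (simp add: conformal_def positive_functional_def)
  next
    case (Suc n)
    have an: "0 < a ^ n" using a by simp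
    define \<Gamma> where "\<Gamma> \<psi> = (\<Lambda> \<psi> - (1 - a ^ n) * \<Lambda>' \<psi>) / a ^ n" for \<psi>
    have "conformal \<Gamma>"
      unfolding conformal_def positive_functional_def
    proof (intro conjI allI impI)
      show "linear_functional \<Gamma>"
        unfolding linear_functional_def
      proof (intro allI impI)
        fix \<phi> \<psi> :: "circle \<Rightarrow> real" and u v :: real
        assume "continuous_on UNIV \<phi>" "continuous_on UNIV \<psi>"
        then have "\<Lambda> (\<lambda>x. u * \<phi> x + v * \<psi> x) = u * \<Lambda> \<phi> + v * \<Lambda> \<psi>"
          "\<Lambda>' (\<lambda>x. u * \<phi> x + v * \<psi> x) = u * \<Lambda>' \<phi> + v * \<Lambda>' \<psi>"
          using lin unfolding linear_functional_def by blast+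
        then show "\<Gamma> (\<lambda>x. u * \<phi> x + v * \<psi> x) = u * \<Gamma> \<phi> + v * \<Gamma> \<psi>"
          by (simp add: \<Gamma>_def add_divide_distrib diff_divide_distrib algebra_simps)
      qed
      show "\<Gamma> (\<lambda>_. 1) = 1"
        using \<Lambda> \<Lambda>' a(1) by (simp add: conformal_def \<Gamma>_def)
      show "0 \<le> \<Gamma> \<phi>" if "continuous_on UNIV \<phi>" "\<forall>x. 0 \<le> \<phi> x" for \<phi>
        using Suc.IH[of \<phi>] that an by (simp add: \<Gamma>_def)
      show "\<Gamma> (transfer \<phi>) = \<Gamma> \<phi>" if "continuous_on UNIV \<phi>" for \<phi>
        using \<Lambda> \<Lambda>' that by (simp add: conformal_def \<Gamma>_def)
    qed
    then have "\<Lambda>' \<psi> \<le> exp (8 * D) * \<Gamma> \<psi>"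
      by (rule conformal_comparison[OF \<Lambda>' _ Suc.prems])
    then have "exp (- (8 * D)) * \<Lambda>' \<psi> \<le> exp (- (8 * D)) * (exp (8 * D) * \<Gamma> \<psi>)"
      by (rule mult_left_mono) simp
    also have "\<dots> = \<Gamma> \<psi>" by (simp add: mult.assoc[symmetric] flip: exp_add)
    finally have "exp (- (8 * D)) * \<Lambda>' \<psi> \<le> \<Gamma> \<psi>" .
    moreover have "0 \<le> \<Lambda>' \<psi>"
      using \<Lambda>' Suc.prems by (simp add: conformal_def positive_functional_def)
    then have "(1 - a) * \<Lambda>' \<psi> \<le> exp (- (8 * D)) * \<Lambda>' \<psi>"
      by (intro mult_right_mono) (simp_all add: a_def)
    ultimately have "(1 - a) * \<Lambda>' \<psi> \<le> \<Gamma> \<psi>" by linarith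
    then have "a ^ n * ((1 - a) * \<Lambda>' \<psi>) \<le> a ^ n * \<Gamma> \<psi>"
      using an by simp
    also have "a ^ n * \<Gamma> \<psi> = \<Lambda> \<psi> - (1 - a ^ n) * \<Lambda>' \<psi>"
      using a(1) by (simp add: \<Gamma>_def)
    finally show ?case by (simp add: algebra_simps)
  qed
  have "(\<lambda>n. (1 - a ^ n) * \<Lambda>' \<phi>) \<longlonglongrightarrow> (1 - 0) * \<Lambda>' \<phi>"
    by (intro tendsto_intros LIMSEQ_power_zero) (use a in simp)
  then have "(1 - 0) * \<Lambda>' \<phi> \<le> \<Lambda> \<phi>"
    by (rule LIMSEQ_le_const2) (use geometric[OF \<phi>] in blast)
  then show ?thesis by simp
qed

text \<open>
  Domination holds in both directions for nonnegative functions; adding a constant makes any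
  continuous function nonnegative.
\<close>

lemma conformal_unique:
  assumes \<Lambda>: "conformal \<Lambda>" and \<Lambda>': "conformal \<Lambda>'" and \<phi>: "continuous_on UNIV \<phi>"
  shows "\<Lambda> \<phi> = \<Lambda>' \<phi>"
proof -
  obtain M where M: "\<And>x. \<bar>\<phi> x\<bar> \<le> M"
    using continuous_circle_bounded[OF \<phi>] by metis
  have c: "continuous_on UNIV (\<lambda>x. M + \<phi> x)" by (intro continuous_intros \<phi>)
  have nn: "0 \<le> M + \<phi> x" for x using M[of x] by linarith
  have "\<Lambda> (\<lambda>x. M + \<phi> x) = \<Lambda>' (\<lambda>x. M + \<phi> x)"
    by (rule antisym[OF conformal_dominates[OF \<Lambda>' \<Lambda> c nn] conformal_dominates[OF \<Lambda> \<Lambda>' c nn]])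
  moreover have split: "\<Gamma> (\<lambda>x. M + \<phi> x) = M + \<Gamma> \<phi>" if "conformal \<Gamma>" for \<Gamma>
    using that linear_functionalD(1)[of \<Gamma> "\<lambda>_. M" \<phi>] positive_functional_const[of \<Gamma> M] \<phi>
    by (simp add: conformal_def positive_functional_def)
  ultimately show ?thesis using split[OF \<Lambda>] split[OF \<Lambda>'] by simp
qed

end

context tame_cocycle
begin

section \<open>Existence of a conformal measure\<close>

text \<open>
  The transfer operator shifts the orbit segment by one step, so the weighted orbit segment fails to
  be conformal only through its two end points.
\<close>

lemma orbit_sum_transfer:
  "orbit_sum n (transfer \<phi>) x =
     orbit_sum n \<phi> x - \<phi> x + exp (birkhoff \<alpha> f n x) * \<phi> (x + to_circle (real n * \<alpha>))"
proof (induction n)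
  case 0
  show ?case by (simp add: orbit_sum_def)
next
  case (Suc n)
  have "exp (birkhoff \<alpha> f (Suc n) x) = exp (birkhoff \<alpha> f n x) * exp (f (x + to_circle (real n * \<alpha>)))"
    by (simp add: birkhoff_def exp_add)
  then show ?case
    using Suc by (simp add: orbit_sum_def transfer_def algebra_simps to_circle_add)
qed

text \<open>
  Every good denominator contributes a term of at least \<open>exp (- 2 D)\<close>.
\<close>

lemma orbit_sum_1_unbounded:
  obtains N where "\<And>n. N \<le> n \<Longrightarrow> B \<le> orbit_sum n (\<lambda>_. 1) x"
proof -
  have step: "\<exists>N. \<forall>n\<ge>N. real m * exp (- (2 * D)) \<le> orbit_sum n (\<lambda>_. 1) x" for m
  proof (induction m)
    case 0
    show ?case by (auto simp: orbit_sum_def intro!: sum_nonneg)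
  next
    case (Suc m)
    then obtain N where N: "\<And>n. N \<le> n \<Longrightarrow> real m * exp (- (2 * D)) \<le> orbit_sum n (\<lambda>_. 1) x"
      by blast
    obtain q where q: "N < q" "good_denominator \<alpha> q"
      using unbounded_good_denominators[OF irrational] .
    show ?case
    proof (intro exI[of _ "Suc q"] allI impI)
      fix n assume "Suc q \<le> n"
      then have "orbit_sum (Suc q) (\<lambda>_. 1) x \<le> orbit_sum n (\<lambda>_. 1) x"
        unfolding orbit_sum_def by (intro sum_mono2) auto
      moreover have "orbit_sum (Suc q) (\<lambda>_. 1) x = orbit_sum q (\<lambda>_. 1) x + exp (birkhoff \<alpha> f q x)"
        by (simp add: orbit_sum_def)
      moreover have "exp (- (2 * D)) \<le> exp (birkhoff \<alpha> f q x)"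
        using birkhoff_good_denominator[OF q(2), of x] by simp
      moreover have "real m * exp (- (2 * D)) \<le> orbit_sum q (\<lambda>_. 1) x"
        using N[of q] q(1) by simp
      ultimately have "real m * exp (- (2 * D)) + exp (- (2 * D)) \<le> orbit_sum n (\<lambda>_. 1) x"
        by linarith
      then show "real (Suc m) * exp (- (2 * D)) \<le> orbit_sum n (\<lambda>_. 1) x"
        by (simp add: algebra_simps)
    qed
  qed
  obtain m :: nat where "B / exp (- (2 * D)) \<le> real m"
    using real_arch_simple by blast
  then have "B \<le> real m * exp (- (2 * D))"
    by (simp add: pos_divide_le_eq)
  with step[of m] that show thesis by (meson order_trans)
qed

text \<open>
  The normalised weights on the orbit of \<open>0\<close>, as a measure on the real line concentrated on \<open>{0..<1}\<close>, so
  that Helly's selection theorem applies.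
\<close>

definition orbit_measure :: "nat \<Rightarrow> real measure" where
  "orbit_measure n = distr
     (point_measure {..<n} (\<lambda>i. ennreal (exp (birkhoff \<alpha> f i 0) / orbit_sum n (\<lambda>_. 1) 0)))
     borel (\<lambda>i. frac (real i * \<alpha>))"

lemma orbit_sum_1_pos: "0 < n \<Longrightarrow> 0 < orbit_sum n (\<lambda>_. 1) x"
  unfolding orbit_sum_def by (intro sum_pos) auto

lemma prob_space_orbit_point_measure:
  assumes "0 < n"
  shows "prob_space (point_measure {..<n} (\<lambda>i. ennreal (exp (birkhoff \<alpha> f i 0) / orbit_sum n (\<lambda>_. 1) 0)))"
proof (rule prob_spaceI)
  let ?W = "orbit_sum n (\<lambda>_. 1) 0"
  have "0 < ?W" using assms by (rule orbit_sum_1_pos)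
  have "(\<Sum>i<n. ennreal (exp (birkhoff \<alpha> f i 0) / ?W)) = ennreal (\<Sum>i<n. exp (birkhoff \<alpha> f i 0) / ?W)"
    using \<open>0 < ?W\<close> by (intro sum_ennreal) simp
  also have "(\<Sum>i<n. exp (birkhoff \<alpha> f i 0) / ?W) = ?W / ?W"
    by (simp add: orbit_sum_def flip: sum_divide_distrib)
  also have "\<dots> = 1" using \<open>0 < ?W\<close> by simp
  finally show "emeasure (point_measure {..<n} (\<lambda>i. ennreal (exp (birkhoff \<alpha> f i 0) / ?W)))
      (space (point_measure {..<n} (\<lambda>i. ennreal (exp (birkhoff \<alpha> f i 0) / ?W)))) = 1"
    by (simp add: space_point_measure emeasure_point_measure_finite)
qed

lemma real_distribution_orbit_measure:
  assumes "0 < n"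
  shows "real_distribution (orbit_measure n)"
  unfolding orbit_measure_def
  by (intro prob_space.real_distribution_distr prob_space_orbit_point_measure assms) simp

lemma orbit_measure_support:
  assumes "0 < n"
  shows "measure (orbit_measure n) {-1<..2} = 1"
proof -
  let ?P = "point_measure {..<n} (\<lambda>i. ennreal (exp (birkhoff \<alpha> f i 0) / orbit_sum n (\<lambda>_. 1) 0))"
  interpret prob_space ?P
    by (rule prob_space_orbit_point_measure[OF assms])
  have "-1 < frac t \<and> frac t \<le> 2" for t :: real
    using frac_ge_0[of t] frac_lt_1[of t] by linarith
  then have "(\<lambda>i. frac (real i * \<alpha>)) -` {-1<..2} \<inter> space ?P = space ?P"
    by auto
  then show ?thesis
    unfolding orbit_measure_def by (subst measure_distr) (simp_all add: prob_space)
qed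

lemma integral_orbit_measure:
  assumes "continuous_on UNIV \<phi>"
  shows "(\<integral>t. \<phi> (to_circle t) \<partial>orbit_measure n) = orbit_sum n \<phi> 0 / orbit_sum n (\<lambda>_. 1) 0"
proof -
  have [measurable]: "\<phi> \<in> borel_measurable borel"
    by (rule borel_measurable_continuous_onI[OF assms])
  have W: "0 \<le> orbit_sum n (\<lambda>_. 1) 0"
    unfolding orbit_sum_def by (intro sum_nonneg) simp
  have "(\<integral>t. \<phi> (to_circle t) \<partial>orbit_measure n) =
      (\<Sum>i<n. exp (birkhoff \<alpha> f i 0) / orbit_sum n (\<lambda>_. 1) 0 * \<phi> (to_circle (frac (real i * \<alpha>))))"
    unfolding orbit_measure_def using W
    by (subst integral_distr) (simp_all add: lebesgue_integral_point_measure_finite)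
  also have "\<dots> = orbit_sum n \<phi> 0 / orbit_sum n (\<lambda>_. 1) 0"
  proof -
    have "to_circle (frac (real i * \<alpha>)) = to_circle (real i * \<alpha>)" for i
      by (simp add: to_circle_eq_iff frac_def)
    then show ?thesis
      by (simp add: orbit_sum_def[of n \<phi>] sum_divide_distrib)
  qed
  finally show ?thesis .
qed

text \<open>
  A weak limit of the orbit measures along good denominators: the defect of conformality is bounded
  by \<open>(1 + exp (2 D)) sup \<bar>\<phi>\<bar>\<close> before division by the total weight, which tends to infinity.
\<close>

lemma conformal_measure_exists:
  obtains \<nu> where "prob_space \<nu>" "sets \<nu> = sets borel" "conformal (\<lambda>\<phi>. \<integral>x. \<phi> x \<partial>\<nu>)"
proof -
  have "\<exists>q. n < q \<and> good_denominator \<alpha> q" for n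
    using unbounded_good_denominators[OF irrational, of n] by blast
  then obtain q where q: "\<And>n. n < q n" "\<And>n. good_denominator \<alpha> (q n)"
    by metis
  have q0: "0 < q n" for n using q(1)[of n] by simp
  define \<mu> where "\<mu> n = orbit_measure (q n)" for n
  have rd: "real_distribution (\<mu> n)" for n
    unfolding \<mu>_def by (rule real_distribution_orbit_measure[OF q0])
  have "tight \<mu>"
    unfolding tight_def
    by (intro conjI allI impI rd exI[of _ "-1"] exI[of _ 2])
      (simp_all add: \<mu>_def orbit_measure_support[OF q0])
  then obtain s M where s: "strict_mono s" and M: "real_distribution M" and conv: "weak_conv_m (\<mu> \<circ> s) M"
    using tight_imp_convergent_subsubsequence[of \<mu> id] by (auto simp: strict_mono_def)
  interpret M: real_distribution M by fact
  let ?L = "\<lambda>\<phi>. \<integral>t. \<phi> (to_circle t) \<partial>M"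
  have lim: "(\<lambda>n. orbit_sum (q (s n)) \<phi> 0 / orbit_sum (q (s n)) (\<lambda>_. 1) 0) \<longlonglongrightarrow> ?L \<phi>"
    if \<phi>: "continuous_on UNIV \<phi>" for \<phi>
  proof -
    obtain B where "\<And>x. \<bar>\<phi> x\<bar> \<le> B"
      using continuous_circle_bounded[OF \<phi>] by metis
    then have "(\<lambda>n. \<integral>t. \<phi> (to_circle t) \<partial>(\<mu> \<circ> s) n) \<longlonglongrightarrow> ?L \<phi>"
      using continuous_on_lift[OF \<phi>, of UNIV]
      by (intro weak_conv_imp_integral_bdd_continuous_conv[OF _ M conv, of _ B])
        (auto simp: rd continuous_on_eq_continuous_at)
    then show ?thesis
      by (simp add: \<mu>_def integral_orbit_measure[OF \<phi>])
  qed
  have invariant: "?L (transfer \<phi>) = ?L \<phi>" if \<phi>: "continuous_on UNIV \<phi>" for \<phi>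
  proof -
    obtain B where B: "0 < B" "\<And>x. \<bar>\<phi> x\<bar> \<le> B"
      using continuous_circle_bounded[OF \<phi>] by metis
    define C where "C = B + exp (2 * D) * B"
    let ?W = "\<lambda>n. orbit_sum (q (s n)) (\<lambda>_. 1) 0"
    let ?d = "\<lambda>n. orbit_sum (q (s n)) (transfer \<phi>) 0 / ?W n - orbit_sum (q (s n)) \<phi> 0 / ?W n"
    have "filterlim ?W at_top sequentially"
      unfolding filterlim_at_top
    proof
      fix Z
      obtain N where N: "\<And>n. N \<le> n \<Longrightarrow> Z \<le> orbit_sum n (\<lambda>_. 1) 0"
        using orbit_sum_1_unbounded[of Z 0] by blast
      have "N \<le> q (s n)" if "N \<le> n" for n
        using that seq_suble[OF s, of n] q(1)[of "s n"] by linarith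
      then show "eventually (\<lambda>n. Z \<le> ?W n) sequentially"
        using N unfolding eventually_sequentially by blast
    qed
    then have "(\<lambda>n. C / ?W n) \<longlonglongrightarrow> 0"
      by (rule real_tendsto_divide_at_top[OF tendsto_const])
    moreover have "norm (?d n) \<le> C / ?W n" for n
    proof -
      have W: "0 < ?W n" by (rule orbit_sum_1_pos[OF q0])
      let ?b = "birkhoff \<alpha> f (q (s n)) 0"
      have "\<bar>exp ?b * \<phi> (0 + to_circle (real (q (s n)) * \<alpha>))\<bar> \<le> exp (2 * D) * B"
        unfolding abs_mult using birkhoff_good_denominator[OF q(2)[of "s n"], of 0] B
        by (intro mult_mono) (auto simp: abs_le_iff)
      then have "\<bar>orbit_sum (q (s n)) (transfer \<phi>) 0 - orbit_sum (q (s n)) \<phi> 0\<bar> \<le> C"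
        unfolding orbit_sum_transfer C_def using B(2)[of 0] by linarith
      then show ?thesis
        using W by (simp add: divide_right_mono flip: diff_divide_distrib)
    qed
    ultimately have vanish: "?d \<longlonglongrightarrow> 0"
      by (intro Lim_null_comparison[of ?d, OF always_eventually]) auto
    have "?d \<longlonglongrightarrow> ?L (transfer \<phi>) - ?L \<phi>"
      by (rule tendsto_diff[OF lim[OF continuous_on_transfer[OF \<phi>]] lim[OF \<phi>]])
    from LIMSEQ_unique[OF this vanish] show ?thesis by simp
  qed
  define \<nu> where "\<nu> = distr M borel to_circle"
  have prob: "prob_space \<nu>"
    unfolding \<nu>_def by (intro M.prob_space_distr) simp
  have sets: "sets \<nu> = sets borel"
    by (simp add: \<nu>_def)
  have \<nu>: "(\<integral>x. \<phi> x \<partial>\<nu>) = ?L \<phi>" if "continuous_on UNIV \<phi>" for \<phi> :: "circle \<Rightarrow> real"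
    unfolding \<nu>_def using borel_measurable_continuous_onI[OF that] by (subst integral_distr) simp_all
  have "positive_functional (\<lambda>\<phi>. \<integral>x. \<phi> x \<partial>\<nu>)"
    using positive_functional_integral[OF prob sets, of "\<lambda>_. 1"] by simp
  moreover have "(\<integral>x. transfer \<phi> x \<partial>\<nu>) = (\<integral>x. \<phi> x \<partial>\<nu>)" if "continuous_on UNIV \<phi>" for \<phi>
    using invariant[OF that] by (simp add: \<nu> that continuous_on_transfer)
  ultimately have "conformal (\<lambda>\<phi>. \<integral>x. \<phi> x \<partial>\<nu>)"
    using prob_space.prob_space[OF prob] by (simp add: conformal_def)
  with prob sets show thesis by (rule that)
qed

end

section \<open>Measures are determined by continuous functions\<close>

text \<open>
  The distance to the complement, taken on the line: it is a periodic function there because the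
  complement is invariant under integer translations.
\<close>

lemma open_circle_positivity_set:
  fixes U :: "circle set"
  assumes "open U"
  obtains g :: "circle \<Rightarrow> real" where "continuous_on UNIV g" "\<And>x. 0 \<le> g x" "\<And>x. x \<in> U \<longleftrightarrow> 0 < g x"
proof (cases "U = UNIV")
  case True
  then show thesis by (intro that[of "\<lambda>_. 1"]) auto
next
  case False
  let ?C = "- (to_circle -` U)"
  have C: "closed ?C"
    using assms by (simp add: open_circle_def closed_def)
  have ne: "?C \<noteq> {}"
  proof -
    obtain x where "x \<notin> U" using False by blast
    moreover obtain t where "x = to_circle t" by (rule circle_exhaust)
    ultimately show ?thesis by blast
  qed
  have per: "infdist s ?C \<le> infdist t ?C" if st: "to_circle s = to_circle t" for s t
  proof -
    obtain a where a: "a \<in> ?C" "infdist t ?C = dist t a"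
      using infdist_attains_inf[OF C ne] by blast
    have "a + (s - t) \<in> ?C"
      using a(1) st by (simp add: to_circle_add to_circle_diff)
    then have "infdist s ?C \<le> dist s (a + (s - t))"
      by (rule infdist_le)
    also have "\<dots> = infdist t ?C"
      by (simp add: a(2) dist_real_def)
    finally show ?thesis .
  qed
  define g where "g x = infdist (SOME t. to_circle t = x) ?C" for x
  have g: "g (to_circle t) = infdist t ?C" for t
  proof -
    have "to_circle (SOME s. to_circle s = to_circle t) = to_circle t"
      by (rule someI) (rule refl)
    then show ?thesis
      unfolding g_def by (intro antisym per) simp_all
  qed
  show thesis
  proof (rule that)
    show "continuous_on UNIV g"
      unfolding continuous_on_open_vimage[OF open_UNIV]
    proof (intro allI impI)
      fix B :: "real set" assume "open B"
      have "to_circle -` (g -` B) = (\<lambda>t. infdist t ?C) -` B"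
        by (auto simp: g)
      also have "open \<dots>"
        by (rule open_vimage[OF \<open>open B\<close>]) (intro continuous_intros)
      finally show "open (g -` B \<inter> UNIV)"
        by (simp add: open_circle_def)
    qed
    show "0 \<le> g x" for x by (simp add: g_def infdist_nonneg)
    show "x \<in> U \<longleftrightarrow> 0 < g x" for x
    proof -
      obtain t where t: "x = to_circle t" by (rule circle_exhaust)
      have "t \<in> ?C \<longleftrightarrow> infdist t ?C = 0"
        by (rule in_closed_iff_infdist_zero[OF C ne])
      then show ?thesis
        using infdist_nonneg[of t ?C] by (auto simp: t g)
    qed
  qed
qed

text \<open>
  The indicator of an open set \<open>{x. 0 < g x}\<close> is the increasing limit of \<open>min 1 (n g)\<close>, and the open
  sets form a generator of the Borel sets that is stable under intersection.
\<close>

lemma circle_measure_eqI: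
  assumes \<mu>: "prob_space \<mu>" "sets \<mu> = sets (borel :: circle measure)"
    and \<nu>: "prob_space \<nu>" "sets \<nu> = sets (borel :: circle measure)"
    and eq: "\<And>\<phi> :: circle \<Rightarrow> real. continuous_on UNIV \<phi> \<Longrightarrow> (\<integral>x. \<phi> x \<partial>\<mu>) = (\<integral>x. \<phi> x \<partial>\<nu>)"
  shows "\<mu> = \<nu>"
proof (rule measure_eqI_generator_eq[where E = "{U. open U}" and \<Omega> = UNIV and A = "\<lambda>_. UNIV"])
  show "Int_stable {U :: circle set. open U}"
    by (auto simp: Int_stable_def)
  show "sets \<mu> = sigma_sets UNIV {U. open U}" "sets \<nu> = sigma_sets UNIV {U. open U}"
    by (simp_all add: \<mu>(2) \<nu>(2) borel_def)
  show "emeasure \<mu> UNIV \<noteq> \<infinity>" for i :: nat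
    using prob_space.emeasure_space_1[OF \<mu>(1)] sets_eq_imp_space_eq[OF \<mu>(2)] by simp
  fix U :: "circle set" assume "U \<in> {U. open U}"
  then have "open U" by simp
  then obtain g :: "circle \<Rightarrow> real" where g: "continuous_on UNIV g" "\<And>x. 0 \<le> g x" "\<And>x. x \<in> U \<longleftrightarrow> 0 < g x"
    using open_circle_positivity_set by blast
  let ?h = "\<lambda>n x. min 1 (real n * g x)"
  have ch: "continuous_on UNIV (?h n)" for n
    by (intro continuous_intros g)
  have lim: "(\<lambda>n. \<integral>x. ?h n x \<partial>\<kappa>) \<longlonglongrightarrow> measure \<kappa> U"
    if \<kappa>: "prob_space \<kappa>" "sets \<kappa> = sets borel" for \<kappa>
  proof -
    interpret \<kappa>: prob_space \<kappa> by fact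
    have U: "U \<in> sets \<kappa>" using \<open>open U\<close> by (simp add: \<kappa>(2))
    have meas: "?h n \<in> borel_measurable \<kappa>" for n
      using borel_measurable_continuous_onI[OF ch] by (simp add: measurable_cong_sets[OF \<kappa>(2) refl])
    have "(\<lambda>n. \<integral>x. ?h n x \<partial>\<kappa>) \<longlonglongrightarrow> (\<integral>x. indicator U x \<partial>\<kappa>)"
    proof (rule integral_dominated_convergence[where w = "\<lambda>_. 1"])
      show "AE x in \<kappa>. (\<lambda>n. ?h n x) \<longlonglongrightarrow> indicator U x"
      proof (rule AE_I2)
        fix x
        show "(\<lambda>n. ?h n x) \<longlonglongrightarrow> indicator U x"
        proof (cases "x \<in> U")
          case True
          then have gx: "0 < g x" by (simp add: g(3))
          obtain N :: nat where N: "1 / g x \<le> real N" using real_arch_simple by blast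
          have "?h n x = 1" if "N \<le> n" for n
          proof -
            have "1 / g x \<le> real n" using N that by linarith
            then show ?thesis using gx by (simp add: pos_divide_le_eq)
          qed
          then have "eventually (\<lambda>n. ?h n x = indicator U x) sequentially"
            using True by (auto simp: eventually_sequentially)
          then show ?thesis by (rule tendsto_eventually)
        next
          case False
          then have "g x = 0" using g(2,3)[of x] by auto
          then show ?thesis using False by simp
        qed
      qed
      show "AE x in \<kappa>. norm (?h n x) \<le> 1" for n
        using g(2) by (intro AE_I2) (simp add: abs_le_iff min_def)
      show "(indicator U :: circle \<Rightarrow> real) \<in> borel_measurable \<kappa>"
        using U by simp
    qed (use meas in auto)
    then show ?thesis using U by simp
  qed
  have "measure \<mu> U = measure \<nu> U"
    using lim[OF \<mu>] lim[OF \<nu>] unfolding eq[OF ch] by (rule LIMSEQ_unique)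
  then show "emeasure \<mu> U = emeasure \<nu> U"
    by (simp add: \<mu>(1) \<nu>(1) prob_space.finite_measure finite_measure.emeasure_eq_measure)
qed auto

section \<open>Stationarity as an integral identity\<close>

lemma nn_integral_walk_kernel:
  assumes [measurable]: "f \<in> borel_measurable borel"
  shows "(\<integral>\<^sup>+y. f y \<partial>walk_kernel \<alpha> p q x) =
    ennreal (p x) * f (x + to_circle \<alpha>) + ennreal (q x) * f (x - to_circle \<alpha>)"
proof -
  let ?P = "point_measure UNIV (\<lambda>b. if b then ennreal (p x) else ennreal (q x))"
  let ?s = "\<lambda>b. if b then x + to_circle \<alpha> else x - to_circle \<alpha>"
  have int: "(\<integral>\<^sup>+y. g y \<partial>distr ?P borel ?s) =
      ennreal (p x) * g (x + to_circle \<alpha>) + ennreal (q x) * g (x - to_circle \<alpha>)"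
    if "g \<in> borel_measurable borel" for g
    using that by (subst nn_integral_distr) (simp_all add: nn_integral_point_measure_finite UNIV_bool)
  have "walk_kernel \<alpha> p q x = distr ?P borel ?s"
  proof (rule measure_eqI)
    fix A assume "A \<in> sets (walk_kernel \<alpha> p q x)"
    then have A: "A \<in> sets borel" by simp
    then have "emeasure (distr ?P borel ?s) A = (\<integral>\<^sup>+y. indicator A y \<partial>distr ?P borel ?s)"
      by (simp add: nn_integral_indicator)
    also have "\<dots> = emeasure (walk_kernel \<alpha> p q x) A"
      using A by (subst int) (simp_all add: emeasure_walk_kernel)
    finally show "emeasure (walk_kernel \<alpha> p q x) A = emeasure (distr ?P borel ?s) A" by simp
  qed simp
  then show ?thesis using int[of f] by simp
qed

locale circle_walk =
  fixes \<alpha> :: real and p q :: "circle \<Rightarrow> real"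
  assumes continuous_p: "continuous_on UNIV p"
    and p_bounds: "\<And>x. 0 < p x \<and> p x < 1"
    and q_eq: "\<And>x. q x = 1 - p x"
begin

lemma continuous_q: "continuous_on UNIV q"
  unfolding q_eq[abs_def] by (intro continuous_intros continuous_p)

lemma pq_pos: "0 < p x" "0 < q x" and pq_sum: "p x + q x = 1"
  using p_bounds[of x] by (simp_all add: q_eq)

lemma kernel_measurable: "walk_kernel \<alpha> p q \<in> measurable borel (prob_algebra borel)"
  using pq_pos pq_sum continuous_p continuous_q
  by (intro walk_kernel_measurable borel_measurable_continuous_onI) (auto intro: less_imp_le)

definition step_average :: "(circle \<Rightarrow> real) \<Rightarrow> circle \<Rightarrow> real" where
  "step_average \<phi> x = p x * \<phi> (x + to_circle \<alpha>) + q x * \<phi> (x - to_circle \<alpha>)"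

lemma continuous_on_step_average:
  assumes "continuous_on UNIV \<phi>"
  shows "continuous_on UNIV (step_average \<phi>)"
  using continuous_on_shift[OF assms, of "to_circle \<alpha>"] continuous_on_shift[OF assms, of "- to_circle \<alpha>"]
  unfolding step_average_def[abs_def]
  by (auto intro!: continuous_on_add continuous_on_mult continuous_p continuous_q)

text \<open>
  Passage from the Lebesgue integral of nonnegative functions, in which the Markov property is given,
  to real-valued continuous functions: add a constant, which \<open>step_average\<close> preserves because
  \<open>p + q = 1\<close>.
\<close>

lemma integral_step:
  assumes \<mu>: "prob_space \<mu>" "sets \<mu> = sets borel" and \<nu>: "prob_space \<nu>" "sets \<nu> = sets borel"
    and step: "\<And>f. f \<in> borel_measurable borel \<Longrightarrow>
      (\<integral>\<^sup>+x. f x \<partial>\<nu>) = (\<integral>\<^sup>+x. (\<integral>\<^sup>+y. f y \<partial>walk_kernel \<alpha> p q x) \<partial>\<mu>)"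
    and \<phi>: "continuous_on UNIV \<phi>"
  shows "(\<integral>x. \<phi> x \<partial>\<nu>) = (\<integral>x. step_average \<phi> x \<partial>\<mu>)"
proof -
  interpret \<mu>: prob_space \<mu> by fact
  interpret \<nu>: prob_space \<nu> by fact
  obtain M where M: "\<And>x. \<bar>\<phi> x\<bar> \<le> M"
    using continuous_circle_bounded[OF \<phi>] by metis
  have nn: "0 \<le> \<phi> x + M" for x using M[of x] by linarith
  have c: "continuous_on UNIV (\<lambda>x. \<phi> x + M)" by (intro continuous_intros \<phi>)
  have cs: "continuous_on UNIV (\<lambda>x. step_average \<phi> x + M)"
    by (intro continuous_intros continuous_on_step_average \<phi>)
  have avg: "step_average \<phi> x + M = p x * (\<phi> (x + to_circle \<alpha>) + M) + q x * (\<phi> (x - to_circle \<alpha>) + M)" for x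
    using pq_sum[of x] by (simp add: step_average_def q_eq algebra_simps)
  have nns: "0 \<le> step_average \<phi> x + M" for x
    unfolding avg using pq_pos[of x] nn[of "x + to_circle \<alpha>"] nn[of "x - to_circle \<alpha>"] by simp
  have meas: "(\<lambda>x. ennreal (\<phi> x + M)) \<in> borel_measurable borel"
    using borel_measurable_continuous_onI[OF c] by simp
  have "ennreal (\<integral>x. \<phi> x + M \<partial>\<nu>) = (\<integral>\<^sup>+x. ennreal (\<phi> x + M) \<partial>\<nu>)"
    by (rule nn_integral_eq_integral[symmetric])
      (use integrable_continuous_circle[OF \<nu>.finite_measure_axioms \<nu>(2) c] nn in auto)
  also have "\<dots> = (\<integral>\<^sup>+x. ennreal (step_average \<phi> x + M) \<partial>\<mu>)"
    unfolding step[OF meas] nn_integral_walk_kernel[OF meas] avg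
    using pq_pos nn by (intro nn_integral_cong) (simp add: ennreal_mult' less_imp_le)
  also have "\<dots> = ennreal (\<integral>x. step_average \<phi> x + M \<partial>\<mu>)"
    by (rule nn_integral_eq_integral)
      (use integrable_continuous_circle[OF \<mu>.finite_measure_axioms \<mu>(2) cs] nns in auto)
  finally have "(\<integral>x. \<phi> x + M \<partial>\<nu>) = (\<integral>x. step_average \<phi> x + M \<partial>\<mu>)"
    by (subst (asm) ennreal_inj) (auto intro!: integral_nonneg_AE nn nns)
  moreover have "integrable \<nu> \<phi>" "integrable \<mu> (step_average \<phi>)"
    by (intro integrable_continuous_circle \<phi> continuous_on_step_average \<mu> \<nu>
        \<mu>.finite_measure_axioms \<nu>.finite_measure_axioms)+
  ultimately show ?thesis
    by (simp add: \<mu>.prob_space \<nu>.prob_space)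
qed

text \<open>
  The equation at time \<open>1\<close> gives the identity for \<open>\<mu>\<close>. Conversely the identity propagates to all
  times by the Markov property, since \<open>step_average\<close> preserves continuity.
\<close>

lemma stationary_iff:
  "stationary (walk_kernel \<alpha> p q) \<mu> \<longleftrightarrow> prob_space \<mu> \<and> sets \<mu> = sets borel \<and>
     (\<forall>\<phi>. continuous_on UNIV \<phi> \<longrightarrow> (\<integral>x. step_average \<phi> x \<partial>\<mu>) = (\<integral>x. \<phi> x \<partial>\<mu>))"
proof (cases "prob_space \<mu> \<and> sets \<mu> = sets borel")
  case True
  then have \<mu>: "prob_space \<mu>" "sets \<mu> = sets borel" by auto
  let ?law = "markov_law (walk_kernel \<alpha> p q) \<mu>"
  have law: "prob_space ?law" "sets ?law = sets (PiM UNIV (\<lambda>_. borel))"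
    by (rule prob_space_markov_law[OF kernel_measurable \<mu>] sets_markov_law[OF kernel_measurable \<mu>])+
  have coord: "(\<lambda>\<omega>. \<omega> n) \<in> measurable ?law borel" for n
    by (simp add: measurable_cong_sets[OF law(2) refl])
  define \<nu> where "\<nu> n = distr ?law borel (\<lambda>\<omega>. \<omega> n)" for n
  have \<nu>: "prob_space (\<nu> n)" "sets (\<nu> n) = sets borel" for n
    unfolding \<nu>_def using coord by (auto intro: prob_space.prob_space_distr[OF law(1)])
  have int: "(\<integral>\<omega>. \<phi> (\<omega> n) \<partial>?law) = (\<integral>x. \<phi> x \<partial>\<nu> n)" if "continuous_on UNIV \<phi>" for \<phi> :: "circle \<Rightarrow> real" and n
    unfolding \<nu>_def using coord borel_measurable_continuous_onI[OF that]
    by (subst integral_distr) simp_all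
  have nn: "(\<integral>\<^sup>+x. g x \<partial>\<nu> n) = (\<integral>\<^sup>+\<omega>. g (\<omega> n) \<partial>?law)" if "g \<in> borel_measurable borel" for g n
    unfolding \<nu>_def using coord that by (subst nn_integral_distr) simp_all
  have initial: "\<nu> 0 = \<mu>"
  proof (rule measure_eqI)
    fix A assume "A \<in> sets (\<nu> 0)"
    then have A: "A \<in> sets borel" by (simp add: \<nu>)
    then have "(\<integral>\<^sup>+x. indicator A x \<partial>\<nu> 0) = (\<integral>\<^sup>+x. indicator A x \<partial>\<mu>)"
      by (subst nn) (simp_all add: markov_law_initial[OF kernel_measurable \<mu>])
    then show "emeasure (\<nu> 0) A = emeasure \<mu> A"
      using A by (simp add: \<nu> \<mu>)
  qed (simp add: \<nu> \<mu>)
  have step: "(\<integral>x. \<phi> x \<partial>\<nu> (Suc n)) = (\<integral>x. step_average \<phi> x \<partial>\<nu> n)" if \<phi>: "continuous_on UNIV \<phi>" for \<phi> n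
  proof (rule integral_step[OF \<nu> \<nu> _ \<phi>])
    fix g :: "circle \<Rightarrow> ennreal" assume g: "g \<in> borel_measurable borel"
    have [measurable]: "p \<in> borel_measurable borel" "q \<in> borel_measurable borel"
      by (intro borel_measurable_continuous_onI continuous_p continuous_q)+
    have "(\<lambda>x. \<integral>\<^sup>+y. g y \<partial>walk_kernel \<alpha> p q x) \<in> borel_measurable borel"
      unfolding nn_integral_walk_kernel[OF g] using g by measurable
    then show "(\<integral>\<^sup>+x. g x \<partial>\<nu> (Suc n)) = (\<integral>\<^sup>+x. (\<integral>\<^sup>+y. g y \<partial>walk_kernel \<alpha> p q x) \<partial>\<nu> n)"
      using markov_law_step[OF kernel_measurable \<mu>, of "\<lambda>_. 1" n g] g by (simp add: nn)
  qed
  show ?thesis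
  proof
    assume stat: "stationary (walk_kernel \<alpha> p q) \<mu>"
    have "(\<integral>x. step_average \<phi> x \<partial>\<mu>) = (\<integral>x. \<phi> x \<partial>\<mu>)" if \<phi>: "continuous_on UNIV \<phi>" for \<phi>
    proof -
      have "(\<integral>\<omega>. \<phi> (\<omega> 1) \<partial>?law) = (\<integral>\<omega>. \<phi> (\<omega> 0) \<partial>?law)"
        using stat \<phi> unfolding stationary_def by blast
      then show ?thesis
        using step[OF \<phi>, of 0] by (simp add: int[OF \<phi>] initial)
    qed
    with \<mu> show "prob_space \<mu> \<and> sets \<mu> = sets borel \<and>
      (\<forall>\<phi>. continuous_on UNIV \<phi> \<longrightarrow> (\<integral>x. step_average \<phi> x \<partial>\<mu>) = (\<integral>x. \<phi> x \<partial>\<mu>))" by blast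
  next
    assume "prob_space \<mu> \<and> sets \<mu> = sets borel \<and>
      (\<forall>\<phi>. continuous_on UNIV \<phi> \<longrightarrow> (\<integral>x. step_average \<phi> x \<partial>\<mu>) = (\<integral>x. \<phi> x \<partial>\<mu>))"
    then have inv: "(\<integral>x. step_average \<phi> x \<partial>\<mu>) = (\<integral>x. \<phi> x \<partial>\<mu>)" if "continuous_on UNIV \<phi>" for \<phi>
      using that by blast
    have "(\<integral>x. \<phi> x \<partial>\<nu> n) = (\<integral>x. \<phi> x \<partial>\<mu>)" if "continuous_on UNIV \<phi>"
      for \<phi> :: "circle \<Rightarrow> real" and n
      using that
    proof (induction n arbitrary: \<phi>)
      case 0
      show ?case by (simp add: initial)
    next
      case (Suc n)
      show ?case
        using Suc.IH[OF continuous_on_step_average[OF Suc.prems]] step[OF Suc.prems] inv[OF Suc.prems]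
        by simp
    qed
    then show "stationary (walk_kernel \<alpha> p q) \<mu>"
      using \<mu> by (simp add: stationary_def int)
  qed
qed (auto simp: stationary_def)

end

section \<open>Stationary measures and conformal measures\<close>

lemma integral_pos:
  fixes g :: "circle \<Rightarrow> real"
  assumes \<mu>: "prob_space \<mu>" "sets \<mu> = sets borel" and g: "continuous_on UNIV g" "\<And>x. 0 < g x"
  shows "0 < (\<integral>x. g x \<partial>\<mu>)"
proof -
  interpret \<mu>: prob_space \<mu> by fact
  have "continuous_on UNIV (\<lambda>x. 1 / g x)"
    by (intro continuous_on_divide continuous_on_const g ballI) (use g(2) in \<open>simp add: less_imp_neq[symmetric]\<close>)
  then obtain M where M: "0 < M" "\<And>x. \<bar>1 / g x\<bar> \<le> M"
    using continuous_circle_bounded by blast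
  have "1 / M \<le> g x" for x
    using M(2)[of x] M(1) g(2)[of x] by (simp add: field_simps)
  then have "(\<integral>x. 1 / M \<partial>\<mu>) \<le> (\<integral>x. g x \<partial>\<mu>)"
    by (intro integral_mono integrable_continuous_circle[OF \<mu>.finite_measure_axioms \<mu>(2)] g continuous_on_const)
  then have "1 / M \<le> (\<integral>x. g x \<partial>\<mu>)" by (simp add: \<mu>.prob_space)
  moreover have "0 < 1 / M" using M(1) by simp
  ultimately show ?thesis by linarith
qed

locale symmetric_walk = circle_walk \<alpha> p q + tame_cocycle \<alpha> D "\<lambda>x. ln (p x / q x)"
  for \<alpha> D :: real and p q :: "circle \<Rightarrow> real"
begin

lemma transfer_eq: "transfer \<phi> x = p x / q x * \<phi> (x + to_circle \<alpha>)"
  using pq_pos[of x] by (simp add: transfer_def)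

lemma continuous_on_div_q:
  assumes "continuous_on UNIV \<phi>"
  shows "continuous_on UNIV (\<lambda>x. \<phi> x / q x)"
  by (intro continuous_on_divide assms continuous_q ballI) (use pq_pos(2) in \<open>simp add: less_imp_neq[symmetric]\<close>)

text \<open>
  Detailed balance. The functional \<open>J\<close> is the current of \<open>\<mu>\<close>; stationarity, applied to \<open>\<phi> \<circ> T\<close>, makes it
  invariant under the rotation, hence a multiple of Lebesgue measure, and that multiple vanishes by
  \<open>current_vanishes\<close>.
\<close>

lemma stationary_flux:
  assumes \<mu>: "prob_space \<mu>" "sets \<mu> = sets borel"
    and stat: "\<And>\<phi>. continuous_on UNIV \<phi> \<Longrightarrow> (\<integral>x. step_average \<phi> x \<partial>\<mu>) = (\<integral>x. \<phi> x \<partial>\<mu>)"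
    and \<phi>: "continuous_on UNIV \<phi>"
  shows "(\<integral>x. q x * transfer \<phi> x \<partial>\<mu>) = (\<integral>x. q x * \<phi> x \<partial>\<mu>)"
proof -
  interpret \<mu>: prob_space \<mu> by fact
  note integrable = integrable_continuous_circle[OF \<mu>.finite_measure_axioms \<mu>(2)]
  define J where "J \<phi> = (\<integral>x. p x * \<phi> (x + to_circle \<alpha>) - q x * \<phi> x \<partial>\<mu>)" for \<phi>
  have ip: "integrable \<mu> (\<lambda>x. p x * \<phi> (x + c))" and iq: "integrable \<mu> (\<lambda>x. q x * \<phi> (x + c))"
    if "continuous_on UNIV \<phi>" for \<phi> c
    by (intro integrable continuous_on_mult continuous_p continuous_q continuous_on_shift that)+
  have J_eq: "J \<phi> = (\<integral>x. p x * \<phi> (x + to_circle \<alpha>) \<partial>\<mu>) - (\<integral>x. q x * \<phi> x \<partial>\<mu>)"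
    if "continuous_on UNIV \<phi>" for \<phi>
    unfolding J_def using ip[OF that] iq[OF that, of 0] by simp
  have "linear_functional J"
    unfolding linear_functional_def
  proof (intro allI impI)
    fix \<phi> \<psi> :: "circle \<Rightarrow> real" and a b :: real
    assume c: "continuous_on UNIV \<phi>" "continuous_on UNIV \<psi>"
    have "J (\<lambda>x. a * \<phi> x + b * \<psi> x) = (\<integral>x. a * (p x * \<phi> (x + to_circle \<alpha>) - q x * \<phi> x) +
        b * (p x * \<psi> (x + to_circle \<alpha>) - q x * \<psi> x) \<partial>\<mu>)"
      unfolding J_def by (rule Bochner_Integration.integral_cong) (simp_all add: algebra_simps)
    also have "\<dots> = a * J \<phi> + b * J \<psi>"
      unfolding J_def using ip[OF c(1)] iq[OF c(1), of 0] ip[OF c(2)] iq[OF c(2), of 0] by simp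
    finally show "J (\<lambda>x. a * \<phi> x + b * \<psi> x) = a * J \<phi> + b * J \<psi>" .
  qed
  moreover have "\<bar>J \<phi>\<bar> \<le> M" if \<phi>: "continuous_on UNIV \<phi>" and M: "\<And>x. \<bar>\<phi> x\<bar> \<le> M" for \<phi> M
  proof -
    have "\<bar>p x * \<phi> (x + to_circle \<alpha>) - q x * \<phi> x\<bar> \<le> M" for x
    proof -
      have "\<bar>p x * \<phi> (x + to_circle \<alpha>) - q x * \<phi> x\<bar> \<le> p x * \<bar>\<phi> (x + to_circle \<alpha>)\<bar> + q x * \<bar>\<phi> x\<bar>"
        using abs_triangle_ineq4[of "p x * \<phi> (x + to_circle \<alpha>)" "q x * \<phi> x"] pq_pos[of x]
        by (simp add: abs_mult)
      also have "\<dots> \<le> p x * M + q x * M"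
        using pq_pos[of x] by (intro add_mono mult_left_mono M) auto
      also have "\<dots> = M"
        using pq_sum[of x] by (simp flip: distrib_right)
      finally show ?thesis .
    qed
    moreover have "positive_functional (\<lambda>\<phi>. \<integral>x. 1 * \<phi> x \<partial>\<mu>)"
      by (rule positive_functional_integral[OF \<mu>]) auto
    moreover have "continuous_on UNIV (\<lambda>x. p x * \<phi> (x + to_circle \<alpha>) - q x * \<phi> x)"
      by (intro continuous_on_diff continuous_on_mult continuous_p continuous_q continuous_on_shift \<phi>)
    ultimately show ?thesis
      unfolding J_def
      using positive_functional_abs_le[of "\<lambda>\<phi>. \<integral>x. 1 * \<phi> x \<partial>\<mu>"] by (simp add: \<mu>.prob_space)
  qed
  moreover have "J (\<lambda>x. \<phi> (x + to_circle \<alpha>)) = J \<phi>" if \<phi>: "continuous_on UNIV \<phi>" for \<phi>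
  proof -
    let ?T = "\<lambda>x. \<phi> (x + to_circle \<alpha>)"
    have cT: "continuous_on UNIV ?T" by (rule continuous_on_shift[OF \<phi>])
    have "(\<integral>x. p x * ?T (x + to_circle \<alpha>) \<partial>\<mu>) + (\<integral>x. q x * \<phi> x \<partial>\<mu>) = (\<integral>x. step_average ?T x \<partial>\<mu>)"
      unfolding step_average_def using ip[OF cT, of "to_circle \<alpha>"] iq[OF \<phi>, of 0] by simp
    also have "\<dots> = (\<integral>x. ?T x \<partial>\<mu>)" by (rule stat[OF cT])
    also have "\<dots> = (\<integral>x. p x * ?T x + q x * ?T x \<partial>\<mu>)"
      using pq_sum by (simp flip: distrib_right)
    also have "\<dots> = (\<integral>x. p x * ?T x \<partial>\<mu>) + (\<integral>x. q x * ?T x \<partial>\<mu>)"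
      by (rule Bochner_Integration.integral_add[OF ip[OF \<phi>] iq[OF \<phi>]])
    finally show ?thesis
      using J_eq[OF \<phi>] J_eq[OF cT] by simp
  qed
  ultimately have J: "J \<phi> = J (\<lambda>_. 1) * (\<integral>x. \<phi> x \<partial>circle_lebesgue)" if "continuous_on UNIV \<phi>" for \<phi>
    using rotation_invariant_functional[OF irrational _ _ _ that, of J] by blast
  have transfer: "(\<integral>x. q x * transfer \<phi> x \<partial>\<mu>) = (\<integral>x. q x * \<phi> x \<partial>\<mu>) + J \<phi>" if "continuous_on UNIV \<phi>" for \<phi>
  proof -
    have "q x * transfer \<phi> x = p x * \<phi> (x + to_circle \<alpha>)" for x
      using pq_pos[of x] by (simp add: transfer_eq)
    then show ?thesis using J_eq[OF that] by simp
  qed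
  have "J (\<lambda>_. 1) = 0"
  proof (rule current_vanishes)
    show "positive_functional (\<lambda>\<phi>. \<integral>x. q x * \<phi> x \<partial>\<mu>)"
      by (rule positive_functional_integral[OF \<mu> continuous_q]) (rule less_imp_le[OF pq_pos(2)])
    have "(\<integral>x. q x * 1 \<partial>\<mu>) \<le> (\<integral>x. 1 \<partial>\<mu>)"
      using p_bounds by (intro integral_mono integrable continuous_on_mult continuous_q continuous_on_const)
        (simp_all add: q_eq less_imp_le)
    then show "(\<integral>x. q x * 1 \<partial>\<mu>) \<le> 1" by (simp add: \<mu>.prob_space)
    show "(\<integral>x. q x * transfer \<phi> x \<partial>\<mu>) = (\<integral>x. q x * \<phi> x \<partial>\<mu>) + J (\<lambda>_. 1) * (\<integral>x. \<phi> x \<partial>circle_lebesgue)"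
      if "continuous_on UNIV \<phi>" for \<phi>
      using transfer[OF that] J[OF that] by simp
  qed
  then show ?thesis
    using transfer[OF \<phi>] J[OF \<phi>] by simp
qed

lemma stationary_imp_conformal:
  assumes "stationary (walk_kernel \<alpha> p q) \<mu>"
  shows "conformal (\<lambda>\<phi>. (\<integral>x. q x * \<phi> x \<partial>\<mu>) / (\<integral>x. q x \<partial>\<mu>))"
proof -
  have \<mu>: "prob_space \<mu>" "sets \<mu> = sets borel"
    and stat: "\<And>\<phi>. continuous_on UNIV \<phi> \<Longrightarrow> (\<integral>x. step_average \<phi> x \<partial>\<mu>) = (\<integral>x. \<phi> x \<partial>\<mu>)"
    using assms by (simp_all add: stationary_iff)
  have Z: "0 < (\<integral>x. q x \<partial>\<mu>)" by (rule integral_pos[OF \<mu> continuous_q pq_pos(2)])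
  have "positive_functional (\<lambda>\<phi>. \<integral>x. q x / (\<integral>x. q x \<partial>\<mu>) * \<phi> x \<partial>\<mu>)"
  proof (rule positive_functional_integral[OF \<mu>])
    show "continuous_on UNIV (\<lambda>x. q x / (\<integral>x. q x \<partial>\<mu>))"
      using Z by (intro continuous_on_divide continuous_q continuous_on_const) simp
    show "0 \<le> q x / (\<integral>x. q x \<partial>\<mu>)" for x
      using Z pq_pos(2)[of x] by simp
  qed
  then show ?thesis
    using Z stationary_flux[OF \<mu> stat] by (simp add: conformal_def)
qed

text \<open>
  The conformal functional of \<open>\<mu>\<close>, evaluated at \<open>\<phi> / q\<close>, gives back \<open>\<mu>\<close> up to normalisation.
\<close>

lemma stationary_unique:
  assumes "stationary (walk_kernel \<alpha> p q) \<mu>" "stationary (walk_kernel \<alpha> p q) \<nu>"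
  shows "\<mu> = \<nu>"
proof -
  have \<mu>: "prob_space \<mu>" "sets \<mu> = sets borel" and \<nu>: "prob_space \<nu>" "sets \<nu> = sets borel"
    using assms by (simp_all add: stationary_iff)
  define Z where "Z \<kappa> = (\<integral>x. q x \<partial>\<kappa>)" for \<kappa>
  have Z: "0 < Z \<mu>" "0 < Z \<nu>"
    unfolding Z_def by (rule integral_pos[OF \<mu> continuous_q pq_pos(2)] integral_pos[OF \<nu> continuous_q pq_pos(2)])+
  have eq: "(\<integral>x. \<phi> x \<partial>\<mu>) / Z \<mu> = (\<integral>x. \<phi> x \<partial>\<nu>) / Z \<nu>" if "continuous_on UNIV \<phi>" for \<phi>
    using conformal_unique[OF assms[THEN stationary_imp_conformal] continuous_on_div_q[OF that]]
      pq_pos(2) by (simp add: Z_def less_imp_neq[symmetric])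
  have "Z \<mu> = Z \<nu>"
    using eq[of "\<lambda>_. 1"] \<mu> \<nu> Z by (simp add: prob_space.prob_space)
  with eq Z show ?thesis
    by (intro circle_measure_eqI \<mu> \<nu>) simp
qed

text \<open>
  The normalised measure \<open>\<nu> / q\<close>, for the conformal \<open>\<nu>\<close>. The steps to the right are handled by
  conformality at \<open>\<phi>\<close>, the steps to the left by conformality at \<open>\<psi> = \<phi> \<circ> T\<^sup>-\<^sup>1\<close>.
\<close>

lemma stationary_exists: "\<exists>\<mu>. stationary (walk_kernel \<alpha> p q) \<mu>"
proof -
  obtain \<nu> where \<nu>: "prob_space \<nu>" "sets \<nu> = sets borel" and conf: "conformal (\<lambda>\<phi>. \<integral>x. \<phi> x \<partial>\<nu>)"
    using conformal_measure_exists .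
  interpret \<nu>: prob_space \<nu> by fact
  note integrable = integrable_continuous_circle[OF \<nu>.finite_measure_axioms \<nu>(2)]
  define Z where "Z = (\<integral>x. 1 / q x \<partial>\<nu>)"
  have c1: "continuous_on UNIV (\<lambda>x. 1 / q x)"
    by (rule continuous_on_div_q[OF continuous_on_const])
  have Z: "0 < Z"
    unfolding Z_def by (rule integral_pos[OF \<nu> c1]) (simp add: pq_pos)
  define \<mu> where "\<mu> = density \<nu> (\<lambda>x. ennreal (1 / q x / Z))"
  have mq: "(\<lambda>x. 1 / q x / Z) \<in> borel_measurable \<nu>"
    by (rule borel_measurable_divide[OF borel_measurable_integrable[OF integrable[OF c1]] borel_measurable_const])
  have int: "(\<integral>x. \<phi> x \<partial>\<mu>) = (\<integral>x. \<phi> x / q x \<partial>\<nu>) / Z" if "continuous_on UNIV \<phi>" for \<phi>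
  proof -
    have "(\<integral>x. \<phi> x \<partial>\<mu>) = (\<integral>x. 1 / q x / Z * \<phi> x \<partial>\<nu>)"
      unfolding \<mu>_def using Z pq_pos(2) mq borel_measurable_integrable[OF integrable[OF that]]
      by (subst integral_density) (simp_all add: less_imp_le)
    also have "\<dots> = (\<integral>x. \<phi> x / q x / Z \<partial>\<nu>)" by simp
    also have "\<dots> = (\<integral>x. \<phi> x / q x \<partial>\<nu>) / Z" by (rule integral_divide_zero)
    finally show ?thesis .
  qed
  have sets: "sets \<mu> = sets borel" by (simp add: \<mu>_def \<nu>(2))
  have prob: "prob_space \<mu>"
  proof (rule prob_spaceI)
    have "emeasure \<mu> (space \<mu>) = (\<integral>\<^sup>+x. ennreal (1 / q x / Z) \<partial>\<nu>)"
      unfolding \<mu>_def using mq by (simp add: emeasure_density cong: nn_integral_cong)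
    also have "\<dots> = ennreal (\<integral>x. 1 / q x / Z \<partial>\<nu>)"
      using Z pq_pos(2) by (intro nn_integral_eq_integral integrable_divide_zero integrable[OF c1])
        (simp_all add: less_imp_le)
    also have "(\<integral>x. 1 / q x / Z \<partial>\<nu>) = Z / Z"
      unfolding Z_def by (rule integral_divide_zero)
    also have "ennreal (Z / Z) = 1" using Z by simp
    finally show "emeasure \<mu> (space \<mu>) = 1" .
  qed
  have "(\<integral>x. step_average \<phi> x \<partial>\<mu>) = (\<integral>x. \<phi> x \<partial>\<mu>)" if \<phi>: "continuous_on UNIV \<phi>" for \<phi>
  proof -
    define \<psi> where "\<psi> x = \<phi> (x - to_circle \<alpha>)" for x
    have c\<psi>: "continuous_on UNIV \<psi>"
      using continuous_on_shift[OF \<phi>, of "- to_circle \<alpha>"] by (simp add: \<psi>_def[abs_def])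
    have conf': "(\<integral>x. transfer g x \<partial>\<nu>) = (\<integral>x. g x \<partial>\<nu>)" if "continuous_on UNIV g" for g
      using conf that by (simp add: conformal_def)
    have "(\<integral>x. step_average \<phi> x / q x \<partial>\<nu>) = (\<integral>x. transfer \<phi> x + \<psi> x \<partial>\<nu>)"
      using pq_pos(2) by (intro Bochner_Integration.integral_cong refl)
        (simp add: step_average_def transfer_eq \<psi>_def field_simps less_imp_neq[symmetric])
    also have "\<dots> = (\<integral>x. \<phi> x \<partial>\<nu>) + (\<integral>x. \<psi> x \<partial>\<nu>)"
      by (simp add: Bochner_Integration.integral_add integrable continuous_on_transfer \<phi> c\<psi> conf')
    also have "(\<integral>x. \<psi> x \<partial>\<nu>) = (\<integral>x. transfer \<psi> x \<partial>\<nu>)"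
      by (rule conf'[OF c\<psi>, symmetric])
    also have "(\<integral>x. \<phi> x \<partial>\<nu>) + \<dots> = (\<integral>x. \<phi> x + transfer \<psi> x \<partial>\<nu>)"
      by (simp add: Bochner_Integration.integral_add integrable continuous_on_transfer \<phi> c\<psi>)
    also have "\<dots> = (\<integral>x. \<phi> x / q x \<partial>\<nu>)"
    proof (intro Bochner_Integration.integral_cong refl)
      fix x
      have "\<phi> x + transfer \<psi> x = (q x + p x) * \<phi> x / q x"
        using pq_pos(2)[of x] by (simp add: transfer_eq \<psi>_def field_simps)
      then show "\<phi> x + transfer \<psi> x = \<phi> x / q x"
        using pq_sum[of x] by (simp add: add.commute)
    qed
    finally show ?thesis
      by (simp add: int \<phi> continuous_on_step_average)
  qed
  with prob sets show ?thesis
    by (auto simp: stationary_iff)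
qed

end

theorem theorem1:
  fixes \<alpha> :: real and p q :: "circle \<Rightarrow> real"
  assumes "\<alpha> \<notin> \<rat>"
    and "continuous_on UNIV p"
    and "\<And>x. 0 < p x \<and> p x < 1"
    and "\<And>x. q x = 1 - p x"
    and "(\<integral>x. ln (p x / q x) \<partial>circle_lebesgue) = 0"
    and "continuous_on UNIV (\<lambda>x. ln (p x / q x))"
    and "bounded_variation_circle (\<lambda>x. ln (p x / q x))"
  shows "uniquely_ergodic (walk_kernel \<alpha> p q)"
proof -
  let ?f = "\<lambda>x. ln (p x / q x)"
  obtain V where V: "\<And>n t. mono_on {..n} t \<Longrightarrow> t ` {..n} \<subseteq> {0..1} \<Longrightarrow>
      (\<Sum>i<n. \<bar>?f (to_circle (t (Suc i))) - ?f (to_circle (t i))\<bar>) \<le> V"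
    using assms(7) unfolding bounded_variation_circle_def by blast
  interpret symmetric_walk \<alpha> "14 * V" p q
  proof unfold_locales
    show "\<bar>birkhoff \<alpha> ?f n (x + to_circle r) - birkhoff \<alpha> ?f n x\<bar> \<le> 14 * V"
      if "good_denominator \<alpha> m" "n \<le> m" "\<bar>r\<bar> \<le> 2 / real m" for m n x r
      by (rule birkhoff_distortion[OF assms(6) V that(1,3,2)])
  qed (use assms in blast)+
  show ?thesis
    unfolding uniquely_ergodic_def using stationary_exists stationary_unique by blast
qed

end
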